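(* Let $i,j\in[0,1]$ with $i+j=1$, let $\theta\in\mathbf{Bad}(i)$, and let $\Theta=\{(\theta,y):y\in[0,1]\}$. Then $\mathbf{Bad}(i,j)\cap\Theta$ is absolute winning on $\mathbb{R}$ (points $(\theta,y)$ of $\Theta$ being identified with $y\in\mathbb{R}$).
   Context: $\mathbf{Bad}(i,j)$, for $i,j\in[0,1]$ with $i+j=1$: for $i,j>0$, $$\mathbf{Bad}(i,j)=\left\{(x,y)\in\mathbb{R}^2:\exists c>0\ \forall p_1,p_2\in\mathbb{Z},\ q\in\mathbb{N},\ \ \max\left\{q|qx-p_1|^{1/i},\,q|qy-p_2|^{1/j}\right\}>c\right\},$$ while $\mathbf{Bad}(1,0)=\mathbf{BA}\times\mathbb{R}$ and $\mathbf{Bad}(0,1)=\mathbb{R}\times\mathbf{BA}$, where $\mathbf{BA}=\{x\in\mathbb{R}:\exists c>0\ \forall p\in\mathbb{Z},q\in\mathbb{N}:\ q|qx-p|>c\}$ is the classical set of badly approximable numbers. For $i>0$, $\mathbf{Bad}(i)=\{x\in\mathbb{R}:\exists c>0\ \forall p\in\mathbb{Z},q\in\mathbb{N}:\ q^{1/i}|qx-p|>c\}$, and $\mathbf{Bad}(0)=\mathbb{R}$. Here $\mathbb{N}=\{1,2,\dots\}$. Absolute game on $\mathbb{R}$: let $\beta>0$. In the $\beta$-absolute game on $\mathbb{R}$, Bob starts by choosing a closed ball $B_0=B(x_0,r_0)$ with $x_0\in\mathbb{R}$ and $r_0>0$. At step $n\ge1$, Alice chooses a $\beta_n$-neighborhood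 $A_n$ of a point in $\mathbb{R}$, where $\beta_n\le\beta r_{n-1}$, and then Bob chooses a closed ball $B_n=B(x_n,r_n)\subseteq B_{n-1}\setminus A_n$ with $x_n\in\mathbb{R}$ and $r_n\ge\beta r_{n-1}$. A set $S$ is $\beta$-absolute winning on $\mathbb{R}$ if Alice can force $\bigcap_{n=0}^\infty B_n\cap S\ne\varnothing$. $S$ is absolute winning on $\mathbb{R}$ if it is $\beta$-absolute winning on $\mathbb{R}$ for every $0<\beta<\frac13$.
   Formalization: As stated the claim fails, since Bob may start with a ball disjoint from [0,1]; proved instead: the fibre of Bad(i,j) over the whole line {θ}×ℝ is absolute winning on ℝ, and Bad(i,j)∩Θ is absolute winning when Bob's first ball lies in [0,1]. *)

theory Defs
  imports "HOL-Analysis.Analysis"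
begin

definition BA :: "real set" where
  "BA = {x. \<exists>c>0. \<forall>(p::int) (q::nat). q \<ge> 1 \<longrightarrow>
          real q * \<bar>real q * x - of_int p\<bar> > c}"

definition bad_single :: "real \<Rightarrow> real set" where
  "bad_single i =
     (if i = 0 then UNIV
      else {x. \<exists>c>0. \<forall>(p::int) (q::nat). q \<ge> 1 \<longrightarrow>
              real q powr (1 / i) * \<bar>real q * x - of_int p\<bar> > c})"

definition bad_pair :: "real \<Rightarrow> real \<Rightarrow> (real \<times> real) set" where
  "bad_pair i j =
     (if j = 0 then BA \<times> UNIV
      else if i = 0 then UNIV \<times> BA
      else {(x, y). \<exists>c>0. \<forall>(p1::int) (p2::int) (q::nat). q \<ge> 1 \<longrightarrow>
              max (real q * \<bar>real q * x - of_int p1\<bar> powr (1 / i))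
                  (real q * \<bar>real q * y - of_int p2\<bar> powr (1 / j)) > c})"

definition vertical_segment :: "real \<Rightarrow> (real \<times> real) set" where
  "vertical_segment \<theta> = {(\<theta>, y) | y. y \<in> {0..1}}"

definition vertical_line :: "real \<Rightarrow> (real \<times> real) set" where
  "vertical_line \<theta> = {(\<theta>, y) | y. y \<in> UNIV}"


text \<open>
  A ball on the line is recorded as a pair (centre, radius).  A strategy for Alice maps the
  nonempty list of the balls that Bob has chosen so far, in chronological order, to the
  neighbourhood that she removes.
\<close>

type_synonym alice_strategy = "(real \<times> real) list \<Rightarrow> real \<times> real"

definition legal_strategy :: "real \<Rightarrow> alice_strategy \<Rightarrow> bool" where
  "legal_strategy \<beta> \<sigma> \<longleftrightarrow>
     (\<forall>h. h \<noteq> [] \<and> snd (last h) > 0 \<longrightarrow>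
        0 < snd (\<sigma> h) \<and> snd (\<sigma> h) \<le> \<beta> * snd (last h))"

text \<open>
  The set \<open>J\<close> constrains Bob's first ball only; \<open>J = UNIV\<close> is the game on the real line.
  The neighbourhoods removed by Alice are open.
\<close>

definition bob_play ::
  "real set \<Rightarrow> real \<Rightarrow> alice_strategy \<Rightarrow> (nat \<Rightarrow> real) \<Rightarrow> (nat \<Rightarrow> real) \<Rightarrow> bool" where
  "bob_play J \<beta> \<sigma> x r \<longleftrightarrow>
     r 0 > 0 \<and> cball (x 0) (r 0) \<subseteq> J \<and>
     (\<forall>n. let (a, b) = \<sigma> (map (\<lambda>k. (x k, r k)) [0..<Suc n]) in
        r (Suc n) \<ge> \<beta> * r n \<and>
        cball (x (Suc n)) (r (Suc n)) \<subseteq> cball (x n) (r n) - ball a b)"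

text \<open>
  For \<open>0 < \<beta> < 1/3\<close> Bob always has a legal move, so it suffices to consider infinite plays.
\<close>

definition beta_absolute_winning_from :: "real set \<Rightarrow> real \<Rightarrow> real set \<Rightarrow> bool" where
  "beta_absolute_winning_from J \<beta> S \<longleftrightarrow>
     (\<exists>\<sigma>. legal_strategy \<beta> \<sigma> \<and>
        (\<forall>x r. bob_play J \<beta> \<sigma> x r \<longrightarrow> (\<Inter>n. cball (x n) (r n)) \<inter> S \<noteq> {}))"

definition absolute_winning_from :: "real set \<Rightarrow> real set \<Rightarrow> bool" where
  "absolute_winning_from J S \<longleftrightarrow>
     (\<forall>\<beta>. 0 < \<beta> \<and> \<beta> < 1/3 \<longrightarrow> beta_absolute_winning_from J \<beta> S)"

text \<open>
  No subset of \<open>{0..1}\<close> is absolute winning on the whole line, since Bob may start with a ball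
  disjoint from \<open>{0..1}\<close>.  This notion is therefore meant for sets that are unbounded in both
  directions; for subsets of an interval \<open>J\<close>, use \<open>absolute_winning_from J\<close>.
\<close>

definition absolute_winning :: "real set \<Rightarrow> bool" where
  "absolute_winning S \<longleftrightarrow> absolute_winning_from UNIV S"

end

theory Submission
  imports Defs
begin

text \<open>
  The argument has a game part and an arithmetic part, joined by a potential function.

  \<^emph>\<open>The game.\<close>  Suppose that every ball of Bob issues finitely many small intervals that the outcome
  must avoid, and give an interval of radius \<open>\<rho>\<close> the weight \<open>\<rho> powr \<gamma>\<close>, where \<open>\<beta> powr \<gamma> = 2 / 3\<close>.
  Alice removes the neighbourhood of a weighted median of the centres of those issued intervals that
  still meet Bob's ball.  Bob's next ball is an interval, so it lies on one side of the median, and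
  at most half of the weight survives, whereas at least \<open>2 / 3\<close> of the weight \<open>r powr \<gamma>\<close> of Bob's own
  ball does.  Hence the surviving weight stays below a constant multiple of
  \<open>r powr \<gamma>\<close>, and once the radii tend to \<open>0\<close> every issued interval has been avoided.
  This is \<open>winning_by_covers\<close>.

  \<^emph>\<open>The arithmetic.\<close>  Fix a small \<open>\<delta>\<close>.  A rational point \<open>(p/q, s/q)\<close> is dangerous for \<open>y\<close> if it
  witnesses that \<open>(\<theta>, y)\<close> is not badly approximable with the constant \<open>\<delta>\<close>.  By the pigeonhole
  principle it lies on a line \<open>A * x + B * y + C = 0\<close> with \<open>\<bar>A\<bar> \<le> q powr i\<close> and \<open>\<bar>B\<bar> \<le> q powr j\<close>; for small
  \<open>\<delta>\<close> the assumption on \<open>\<theta>\<close> prevents this line from being vertical.  The line crosses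
  the vertical line over \<open>\<theta>\<close> in one point, and every \<open>y\<close> endangered by \<open>(p/q, s/q)\<close> lies within
  \<open>2 * \<delta> / (q * B)\<close> of that crossing.  So it suffices to see few lines at each scale.

  Sort the dangerous points by the dyadic size \<open>2 ^ (-k)\<close> of \<open>B / q powr j\<close>, and let a ball of radius
  \<open>r\<close> handle those points of the \<open>k\<close>-th class for which \<open>q * B * r\<close> is comparable to
  \<open>T * 2 powr (j * k / 3)\<close>, where \<open>\<delta> = T\<^sup>2\<close>.  Take two points of the same class, dangerous for points of
  the same ball.  If \<open>2 powr (j * k / 3)\<close> is less than a small multiple of \<open>1 / T\<close>, the value of the
  first linear form at the second point is an integer of absolute value below \<open>1\<close>, so the second point
  lies on the first line.  Otherwise both \<open>B\<close>s are so small that the intersection point of the two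
  lines, whose denominator is at most \<open>\<bar>A\<^sub>1 * B\<^sub>2 - A\<^sub>2 * B\<^sub>1\<bar>\<close>, is again dangerous for \<open>y\<close>, with a smaller
  denominator; this cannot happen if the second point was chosen with minimal denominator
  among the points dangerous for \<open>y\<close>, so the two lines cross the vertical line over \<open>\<theta>\<close> in the same
  point.  Either way one interval of radius comparable to \<open>T * 2 powr (- j * k / 3) * r\<close> handles the
  class (\<open>class_shares_crossing\<close>).  The weights of these intervals form a geometric series in \<open>k\<close>
  with a sum as small as desired when \<open>T\<close> is small, which is what the game requires.
\<close>

section \<open>A potential for the absolute game\<close>

lemma weighted_median:
  fixes z w :: "'a \<Rightarrow> real"
  assumes "finite E" and w: "\<And>e. e \<in> E \<Longrightarrow> 0 \<le> w e"
  shows "\<exists>a. 2 * sum w {e \<in> E. z e < a} \<le> sum w E \<and> 2 * sum w {e \<in> E. a < z e} \<le> sum w E"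
proof (cases "E = {}")
  case False
  define L where "L = {a \<in> z ` E. 2 * sum w {e \<in> E. z e < a} \<le> sum w E}"
  have finL: "finite L" unfolding L_def using assms(1) by simp
  have "Min (z ` E) \<in> L"
  proof -
    have "sum w {e \<in> E. z e < Min (z ` E)} = 0"
      using Min_le[of "z ` E"] assms(1) by (intro sum.neutral ballI) fastforce
    moreover have "Min (z ` E) \<in> z ` E" using False assms(1) by (intro Min_in) auto
    ultimately show ?thesis unfolding L_def using sum_nonneg[of E w] w by auto
  qed
  hence "Max L \<in> L" using finL by (intro Max_in) auto
  hence le: "2 * sum w {e \<in> E. z e < Max L} \<le> sum w E" by (simp add: L_def)
  have "2 * sum w {e \<in> E. Max L < z e} \<le> sum w E"
  proof (cases "{e \<in> E. Max L < z e} = {}")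
    case True
    show ?thesis unfolding True using sum_nonneg[of E w] w by simp
  next
    case ne: False
    define b where "b = Min (z ` {e \<in> E. Max L < z e})"
    have "b \<in> z ` {e \<in> E. Max L < z e}"
      unfolding b_def using ne assms(1) by (intro Min_in) auto
    hence b: "b \<in> z ` E" "Max L < b" by auto
    hence "b \<notin> L" using finL Max_ge leD by blast
    hence gt: "sum w E < 2 * sum w {e \<in> E. z e < b}" using b(1) by (auto simp: L_def)
    have "{e \<in> E. z e < b} \<subseteq> E - {e \<in> E. Max L < z e}"
      using Min_le[of "z ` {e \<in> E. Max L < z e}"] assms(1) unfolding b_def by fastforce
    hence "sum w {e \<in> E. z e < b} \<le> sum w (E - {e \<in> E. Max L < z e})"
      using assms by (intro sum_mono2) auto
    also have "\<dots> = sum w E - sum w {e \<in> E. Max L < z e}"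
      using assms(1) by (intro sum_diff) auto
    finally show ?thesis using gt by linarith
  qed
  with le show ?thesis by blast
qed simp

text \<open>
  The step \<open>m\<close> at which an interval was issued is kept in the triple, because an interval issued at
  several steps has to be counted with multiplicity in the proof that the radii tend to \<open>0\<close>.
\<close>

definition alive ::
  "(real \<Rightarrow> real \<Rightarrow> (real \<times> real) set) \<Rightarrow> (real \<times> real) list \<Rightarrow> (nat \<times> real \<times> real) set" where
  "alive F h = {(m, z, \<rho>). m < length h \<and> (z, \<rho>) \<in> F (fst (h ! m)) (snd (h ! m)) \<and>
     ball z \<rho> \<inter> cball (fst (last h)) (snd (last h)) \<noteq> {}}"

definition median :: "real \<Rightarrow> (nat \<times> real \<times> real) set \<Rightarrow> real" where
  "median \<gamma> E = (SOME a.
     2 * sum (\<lambda>(m, z, \<rho>). \<rho> powr \<gamma>) {e \<in> E. fst (snd e) < a} \<le> sum (\<lambda>(m, z, \<rho>). \<rho> powr \<gamma>) E \<and>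
     2 * sum (\<lambda>(m, z, \<rho>). \<rho> powr \<gamma>) {e \<in> E. a < fst (snd e)} \<le> sum (\<lambda>(m, z, \<rho>). \<rho> powr \<gamma>) E)"

lemma median:
  assumes "finite E"
  shows "2 * sum (\<lambda>(m, z, \<rho>). \<rho> powr \<gamma>) {e \<in> E. fst (snd e) < median \<gamma> E}
           \<le> sum (\<lambda>(m, z, \<rho>). \<rho> powr \<gamma>) E"
    and "2 * sum (\<lambda>(m, z, \<rho>). \<rho> powr \<gamma>) {e \<in> E. median \<gamma> E < fst (snd e)}
           \<le> sum (\<lambda>(m, z, \<rho>). \<rho> powr \<gamma>) E"
  using someI_ex[OF weighted_median[OF assms,
      where z = "\<lambda>e. fst (snd e)" and w = "\<lambda>(m, z, \<rho>). \<rho> powr \<gamma>"]]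
  unfolding median_def by auto

lemma interval_beside_ball:
  fixes a b x r :: real
  assumes "b > 0" "r \<ge> 0" "cball x r \<inter> ball a b = {}"
  shows "x + r \<le> a - b \<or> a + b \<le> x - r"
proof (rule ccontr)
  assume "\<not> ?thesis"
  hence *: "a - b < x + r" "x - r < a + b" by auto
  define y where "y = max (x - r) (min a (x + r))"
  have "y \<in> cball x r" "y \<in> ball a b"
    using * assms(1,2) unfolding y_def by (auto simp: dist_real_def abs_if max_def min_def)
  with assms(3) show False by blast
qed

text \<open>
  The new ball lies on one side of the median, at distance at least \<open>b\<close> from it.  An interval of radius
  at most \<open>b\<close> with its centre on the other side cannot reach the ball, so the survivors have all their
  centres strictly on one side.
\<close>

lemma survivors_halve:
  fixes x r x' r' :: real
  assumes fin: "finite E" and "b > 0" "r' \<ge> 0"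
    and small: "\<And>m z \<rho>. (m, z, \<rho>) \<in> E \<Longrightarrow> \<rho> \<le> b"
    and away: "cball x' r' \<inter> ball (median \<gamma> E) b = {}"
  shows "2 * (\<Sum>(m, z, \<rho>) \<in> {(m, z, \<rho>). (m, z, \<rho>) \<in> E \<and> ball z \<rho> \<inter> cball x' r' \<noteq> {}}. \<rho> powr \<gamma>)
           \<le> (\<Sum>(m, z, \<rho>) \<in> E. \<rho> powr \<gamma>)" (is "2 * sum ?w ?H \<le> _")
proof -
  define a where "a = median \<gamma> E"
  have hit: "\<exists>y. \<bar>y - z\<bar> < \<rho> \<and> \<bar>y - x'\<bar> \<le> r'" if "(m, z, \<rho>) \<in> ?H" for m z \<rho>
  proof -
    obtain y where "y \<in> ball z \<rho>" "y \<in> cball x' r'" using \<open>(m, z, \<rho>) \<in> ?H\<close> by auto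
    thus ?thesis by (intro exI[of _ y]) (auto simp: dist_real_def abs_minus_commute)
  qed
  consider "x' + r' \<le> a - b" | "a + b \<le> x' - r'"
    using interval_beside_ball[OF assms(2,3) away] by (auto simp: a_def)
  thus ?thesis
  proof cases
    case 1
    have "?H \<subseteq> {e \<in> E. fst (snd e) < a}"
    proof
      fix e assume e: "e \<in> ?H"
      obtain m z \<rho> where [simp]: "e = (m, z, \<rho>)" by (metis prod_cases3)
      have "\<rho> \<le> b" using e small by auto
      moreover obtain y where "\<bar>y - z\<bar> < \<rho>" "\<bar>y - x'\<bar> \<le> r'" using hit e by fastforce
      ultimately have "z < a" using 1 by linarith
      thus "e \<in> {e \<in> E. fst (snd e) < a}" using e by auto
    qed
    hence "sum ?w ?H \<le> sum ?w {e \<in> E. fst (snd e) < a}"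
      using fin by (intro sum_mono2) auto
    thus ?thesis using median(1)[OF fin, of \<gamma>] unfolding a_def by linarith
  next
    case 2
    have "?H \<subseteq> {e \<in> E. a < fst (snd e)}"
    proof
      fix e assume e: "e \<in> ?H"
      obtain m z \<rho> where [simp]: "e = (m, z, \<rho>)" by (metis prod_cases3)
      have "\<rho> \<le> b" using e small by auto
      moreover obtain y where "\<bar>y - z\<bar> < \<rho>" "\<bar>y - x'\<bar> \<le> r'" using hit e by fastforce
      ultimately have "a < z" using 2 by linarith
      thus "e \<in> {e \<in> E. a < fst (snd e)}" using e by auto
    qed
    hence "sum ?w ?H \<le> sum ?w {e \<in> E. a < fst (snd e)}"
      using fin by (intro sum_mono2) auto
    thus ?thesis using median(2)[OF fin, of \<gamma>] unfolding a_def by linarith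
  qed
qed

lemma finite_alive:
  assumes "\<And>x r. finite (F x r)"
  shows "finite (alive F h)"
proof (rule finite_subset)
  show "alive F h \<subseteq> (SIGMA m : {..<length h}. F (fst (h ! m)) (snd (h ! m)))"
    by (auto simp: alive_def)
qed (use assms in auto)

text \<open>
  A play in which Alice always removes the median of the intervals that are still alive.
\<close>

locale median_play =
  fixes F :: "real \<Rightarrow> real \<Rightarrow> (real \<times> real) set" and \<beta> \<gamma> :: real and x r :: "nat \<Rightarrow> real"
  assumes \<beta>: "0 < \<beta>" and \<gamma>: "0 < \<gamma>" and \<beta>\<gamma>: "\<beta> powr \<gamma> = 2 / 3"
    and finF: "\<And>x r. finite (F x r)"
    and posF: "\<And>x r z \<rho>. 0 < r \<Longrightarrow> (z, \<rho>) \<in> F x r \<Longrightarrow> 0 < \<rho>"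
    and weightF: "\<And>x r. 0 < r \<Longrightarrow> (\<Sum>(z, \<rho>) \<in> F x r. \<rho> powr \<gamma>) \<le> r powr \<gamma> / 6"
    and r0: "0 < r 0"
    and step: "\<And>n. \<beta> * r n \<le> r (Suc n)"
    and nested: "\<And>n. cball (x (Suc n)) (r (Suc n)) \<subseteq> cball (x n) (r n) -
       ball (median \<gamma> (alive F (map (\<lambda>k. (x k, r k)) [0..<Suc n]))) (\<beta> * r n)"
begin

definition A where "A n = alive F (map (\<lambda>k. (x k, r k)) [0..<Suc n])"

definition W where "W n = (\<Sum>(m, z, \<rho>) \<in> A n. \<rho> powr \<gamma>)"

lemma A_iff: "(m, z, \<rho>) \<in> A n \<longleftrightarrow>
    m \<le> n \<and> (z, \<rho>) \<in> F (x m) (r m) \<and> ball z \<rho> \<inter> cball (x n) (r n) \<noteq> {}"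
proof -
  have "map (\<lambda>k. (x k, r k)) [0..<Suc n] ! m = (x m, r m)" if "m < Suc n"
    using that nth_map_upt[of m "Suc n" 0] by simp
  moreover have "last (map (\<lambda>k. (x k, r k)) [0..<Suc n]) = (x n, r n)" by simp
  moreover have "length (map (\<lambda>k. (x k, r k)) [0..<Suc n]) = Suc n" by simp
  ultimately show ?thesis unfolding A_def alive_def by (auto simp: less_Suc_eq_le simp del: upt_Suc)
qed

lemma finite_A: "finite (A n)"
  unfolding A_def using finite_alive finF by blast

lemma r_pos: "0 < r n"
proof (induction n)
  case (Suc n)
  then show ?case using step[of n] \<beta> by (meson less_le_trans mult_pos_pos)
qed (rule r0)

lemma balls_decrease: "m \<le> n \<Longrightarrow> cball (x n) (r n) \<subseteq> cball (x m) (r m)"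
  by (rule lift_Suc_antimono_le[of "\<lambda>n. cball (x n) (r n)"]) (use nested in auto)

lemma radius_le_weight:
  assumes "(m, z, \<rho>) \<in> A n"
  shows "\<rho> powr \<gamma> \<le> W n"
  unfolding W_def using member_le_sum[OF assms, of "\<lambda>(m, z, \<rho>). \<rho> powr \<gamma>"] finite_A by auto

text \<open>
  Measured in units of \<open>r n powr \<gamma>\<close>, one step halves the old weight, multiplies it by at most
  \<open>\<beta> powr (- \<gamma>) = 3 / 2\<close> because the unit shrinks, and adds new weight at most \<open>1 / 6\<close>; the constant \<open>2 / 3\<close> is the
  fixed point \<open>c = (3 / 2) * c / 2 + 1 / 6\<close>.  It equals \<open>\<beta> powr \<gamma>\<close>, so that the bound also says that no
  interval that is still alive is longer than Alice's neighbourhood, as \<open>survivors_halve\<close> requires.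
\<close>

lemma weight_bound: "W n \<le> 2 / 3 * r n powr \<gamma>"
proof (induction n)
  case 0
  have "A 0 \<subseteq> {0} \<times> F (x 0) (r 0)" by (auto simp: A_iff)
  hence "W 0 \<le> (\<Sum>(m, z, \<rho>) \<in> {0::nat} \<times> F (x 0) (r 0). \<rho> powr \<gamma>)"
    unfolding W_def using finF by (intro sum_mono2) auto
  also have "\<dots> = (\<Sum>(z, \<rho>) \<in> F (x 0) (r 0). \<rho> powr \<gamma>)"
    by (subst sum.cartesian_product[symmetric]) simp
  also have "\<dots> \<le> r 0 powr \<gamma> / 6" by (rule weightF[OF r0])
  finally show ?case using powr_ge_zero[of "r 0" \<gamma>] by linarith
next
  case (Suc n)
  have small: "\<rho> \<le> \<beta> * r n" if "(m, z, \<rho>) \<in> A n" for m z \<rho>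
  proof (rule ccontr)
    assume "\<not> \<rho> \<le> \<beta> * r n"
    hence "(\<beta> * r n) powr \<gamma> < \<rho> powr \<gamma>"
      using \<beta> \<gamma> r_pos[of n] by (intro powr_less_mono2) auto
    moreover have "(\<beta> * r n) powr \<gamma> = 2 / 3 * r n powr \<gamma>"
      using \<beta> r_pos[of n] \<beta>\<gamma> by (simp add: powr_mult)
    ultimately show False using radius_le_weight[OF that] Suc by linarith
  qed
  let ?H = "{(m, z, \<rho>). (m, z, \<rho>) \<in> A n \<and> ball z \<rho> \<inter> cball (x (Suc n)) (r (Suc n)) \<noteq> {}}"
  have halve: "2 * (\<Sum>(m, z, \<rho>) \<in> ?H. \<rho> powr \<gamma>) \<le> W n"
    unfolding W_def
  proof (rule survivors_halve[OF finite_A _ _ small])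
    show "cball (x (Suc n)) (r (Suc n)) \<inter> ball (median \<gamma> (A n)) (\<beta> * r n) = {}"
      using nested[of n] unfolding A_def by blast
  qed (use \<beta> r_pos less_imp_le in auto)
  have finH: "finite ?H" by (rule finite_subset[OF _ finite_A[of n]]) auto
  have "A (Suc n) \<subseteq> ?H \<union> {Suc n} \<times> F (x (Suc n)) (r (Suc n))"
  proof
    fix e assume e: "e \<in> A (Suc n)"
    obtain m z \<rho> where [simp]: "e = (m, z, \<rho>)" by (metis prod_cases3)
    show "e \<in> ?H \<union> {Suc n} \<times> F (x (Suc n)) (r (Suc n))"
      using e nested[of n] by (cases "m = Suc n") (auto simp: A_iff)
  qed
  hence "W (Suc n) \<le> (\<Sum>(m, z, \<rho>) \<in> ?H \<union> {Suc n} \<times> F (x (Suc n)) (r (Suc n)). \<rho> powr \<gamma>)"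
    unfolding W_def using finF finH by (intro sum_mono2) auto
  also have "\<dots> \<le> (\<Sum>(m, z, \<rho>) \<in> ?H. \<rho> powr \<gamma>)
      + (\<Sum>(m, z, \<rho>) \<in> {Suc n} \<times> F (x (Suc n)) (r (Suc n)). \<rho> powr \<gamma>)"
    using finH finF by (subst sum.union_disjoint) (auto simp: A_iff)
  also have "(\<Sum>(m, z, \<rho>) \<in> {Suc n} \<times> F (x (Suc n)) (r (Suc n)). \<rho> powr \<gamma>)
      = (\<Sum>(z, \<rho>) \<in> F (x (Suc n)) (r (Suc n)). \<rho> powr \<gamma>)"
    by (subst sum.cartesian_product[symmetric]) simp
  also have "\<dots> \<le> r (Suc n) powr \<gamma> / 6" by (rule weightF[OF r_pos])
  finally have "W (Suc n) \<le> W n / 2 + r (Suc n) powr \<gamma> / 6" using halve by linarith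
  moreover have "2 / 3 * r n powr \<gamma> \<le> r (Suc n) powr \<gamma>"
  proof -
    have "2 / 3 * r n powr \<gamma> = (\<beta> * r n) powr \<gamma>"
      using \<beta> r_pos[of n] \<beta>\<gamma> by (simp add: powr_mult)
    also have "\<dots> \<le> r (Suc n) powr \<gamma>"
      using step[of n] \<gamma> \<beta> r_pos[of n] by (intro powr_mono2) auto
    finally show ?thesis .
  qed
  ultimately show ?case using Suc by linarith
qed

lemma r_decreases: "r (Suc n) \<le> r n"
proof -
  have "cball (x (Suc n)) (r (Suc n)) \<subseteq> cball (x n) (r n)" using nested by blast
  hence "dist (x (Suc n)) (x n) + r (Suc n) \<le> r n"
    using r_pos[of "Suc n"] by (simp add: cball_subset_cball_iff)
  thus ?thesis using zero_le_dist[of "x (Suc n)" "x n"] by linarith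
qed

text \<open>
  If the radii decreased to some \<open>l > 0\<close>, the balls would finally move by less than \<open>\<mu> * l\<close>, so all the
  later central intervals would stay alive together and their weights would add up beyond the bound.
\<close>

lemma radii_tendsto_zero:
  assumes "0 < \<mu>" and centre: "\<And>n. (x n, \<mu> * r n) \<in> F (x n) (r n)"
  shows "r \<longlonglongrightarrow> 0"
proof -
  have anti: "decseq r" using r_decreases by (rule decseq_SucI)
  obtain l where l: "r \<longlonglongrightarrow> l" "\<And>n. l \<le> r n"
    using decseq_convergent[OF anti, of 0] r_pos less_imp_le by metis
  have "l \<ge> 0" using LIMSEQ_le_const[OF l(1)] r_pos less_imp_le by blast
  moreover have False if "l > 0"
  proof -
    have near: "\<exists>N. \<forall>n\<ge>N. r n < l + \<mu> * l" 
      using order_tendstoD(2)[OF l(1), of "l + \<mu> * l"] \<open>l > 0\<close> assms(1)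
      by (auto simp: eventually_sequentially)
    then obtain N where N: "\<And>n. n \<ge> N \<Longrightarrow> r n < l + \<mu> * l" by blast
    have in_A: "(m, x m, \<mu> * r m) \<in> A n" if "N \<le> m" "m \<le> n" for m n
    proof -
      have "cball (x n) (r n) \<subseteq> cball (x m) (r m)" by (rule balls_decrease[OF that(2)])
      hence "dist (x n) (x m) + r n \<le> r m" using r_pos[of n] by (simp add: cball_subset_cball_iff)
      moreover have "r m < l + \<mu> * l" by (rule N[OF that(1)])
      moreover have "\<mu> * l \<le> \<mu> * r m" using l(2) assms(1) by simp
      ultimately have "x n \<in> ball (x m) (\<mu> * r m)" using l(2)[of n] by (simp add: dist_commute)
      moreover have "x n \<in> cball (x n) (r n)" using r_pos[of n] by simp
      ultimately show ?thesis using centre that by (auto simp: A_iff)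
    qed
    have "of_nat k * (\<mu> * l) powr \<gamma> \<le> r 0 powr \<gamma>" for k
    proof -
      define n where "n = N + k"
      have "of_nat k * (\<mu> * l) powr \<gamma> = (\<Sum>m\<in>{N..<n}. (\<mu> * l) powr \<gamma>)" by (simp add: n_def)
      also have "\<dots> \<le> (\<Sum>m\<in>{N..<n}. (\<mu> * r m) powr \<gamma>)"
        using l(2) \<open>l > 0\<close> assms(1) \<gamma> by (intro sum_mono powr_mono2) auto
      also have "\<dots> = (\<Sum>(m, z, \<rho>)\<in>(\<lambda>m. (m, x m, \<mu> * r m)) ` {N..<n}. \<rho> powr \<gamma>)"
        by (subst sum.reindex) (auto simp: inj_on_def)
      also have "\<dots> \<le> W n"
        unfolding W_def using in_A finite_A by (intro sum_mono2) auto
      also have "\<dots> \<le> r n powr \<gamma>" using weight_bound[of n] powr_ge_zero[of "r n" \<gamma>] by linarith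
      also have "\<dots> \<le> r 0 powr \<gamma>"
        using decseqD[OF anti, of 0 n] r_pos[of n] \<gamma> by (intro powr_mono2) auto
      finally show ?thesis .
    qed
    moreover have "(\<mu> * l) powr \<gamma> > 0" using \<open>l > 0\<close> assms(1) by simp
    ultimately show False
      using reals_Archimedean3[of "(\<mu> * l) powr \<gamma>"] by (meson not_less)
  qed
  ultimately show ?thesis using l(1) by (cases "l = 0") auto
qed

lemma eventually_avoided:
  assumes "r \<longlonglongrightarrow> 0" "(z, \<rho>) \<in> F (x m) (r m)" "\<And>n. y \<in> cball (x n) (r n)"
  shows "y \<notin> ball z \<rho>"
proof
  assume "y \<in> ball z \<rho>"
  have pos: "\<rho> > 0" by (rule posF[OF r_pos assms(2)])
  obtain n where n: "n \<ge> m" "r n < \<rho>"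
    using order_tendstoD(2)[OF assms(1) pos] unfolding eventually_sequentially
    by (metis nle_le)
  have "(m, z, \<rho>) \<in> A n" using \<open>y \<in> ball z \<rho>\<close> assms(2,3) n(1) by (auto simp: A_iff)
  hence "\<rho> powr \<gamma> \<le> r n powr \<gamma>"
    using radius_le_weight[of m z \<rho> n] weight_bound[of n] powr_ge_zero[of "r n" \<gamma>] by linarith
  moreover have "r n powr \<gamma> < \<rho> powr \<gamma>" using n(2) r_pos[of n] \<gamma> by (intro powr_less_mono2) auto
  ultimately show False by linarith
qed

end

lemma nested_balls_meet:
  fixes x r :: "nat \<Rightarrow> real"
  assumes "\<And>n. 0 < r n" "\<And>n. cball (x (Suc n)) (r (Suc n)) \<subseteq> cball (x n) (r n)"
  shows "(\<Inter>n. cball (x n) (r n)) \<noteq> {}"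
proof (rule compact_nest)
  show "compact (cball (x n) (r n))" "cball (x n) (r n) \<noteq> {}" for n
    using assms(1)[of n] by auto
  show "cball (x n) (r n) \<subseteq> cball (x m) (r m)" if "m \<le> n" for m n
    by (rule lift_Suc_antimono_le[of "\<lambda>n. cball (x n) (r n)"]) (use assms(2) that in auto)
qed

text \<open>
  The cover \<open>F r\<^sub>0\<close> may depend on Bob's initial radius.  Alice adds a small central interval to every
  family, which forces the radii to tend to \<open>0\<close> at the cost of half of the available weight.
\<close>

lemma winning_by_covers:
  fixes F :: "real \<Rightarrow> real \<Rightarrow> real \<Rightarrow> (real \<times> real) set"
  assumes \<beta>: "0 < \<beta>" and \<gamma>: "0 < \<gamma>" and \<beta>\<gamma>: "\<beta> powr \<gamma> = 2 / 3"
    and finF: "\<And>r\<^sub>0 x r. finite (F r\<^sub>0 x r)"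
    and posF: "\<And>r\<^sub>0 x r z \<rho>. 0 < r\<^sub>0 \<Longrightarrow> 0 < r \<Longrightarrow> (z, \<rho>) \<in> F r\<^sub>0 x r \<Longrightarrow> 0 < \<rho>"
    and weightF: "\<And>r\<^sub>0 x r. 0 < r\<^sub>0 \<Longrightarrow> 0 < r \<Longrightarrow> (\<Sum>(z, \<rho>) \<in> F r\<^sub>0 x r. \<rho> powr \<gamma>) \<le> r powr \<gamma> / 12"
    and target: "\<And>x r y. cball (x 0) (r 0) \<subseteq> J \<Longrightarrow> (\<And>n. 0 < r n) \<Longrightarrow> (\<And>n. \<beta> * r n \<le> r (Suc n)) \<Longrightarrow>
       r \<longlonglongrightarrow> 0 \<Longrightarrow> (\<And>n. y \<in> cball (x n) (r n)) \<Longrightarrow>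
       (\<And>n z \<rho>. (z, \<rho>) \<in> F (r 0) (x n) (r n) \<Longrightarrow> y \<notin> ball z \<rho>) \<Longrightarrow> y \<in> S"
  shows "beta_absolute_winning_from J \<beta> S"
proof -
  \<comment> \<open>With this radius, the central interval weighs \<open>r powr \<gamma> / 12\<close>, as much as the cover may.\<close>
  define \<mu> :: real where "\<mu> = (1 / 12) powr (1 / \<gamma>)"
  have \<mu>: "0 < \<mu>" "\<mu> powr \<gamma> = 1 / 12" using \<gamma> by (simp_all add: \<mu>_def powr_powr)
  define G where "G r\<^sub>0 x r = insert (x, \<mu> * r) (F r\<^sub>0 x r)" for r\<^sub>0 x r
  define \<sigma> where "\<sigma> h = (median \<gamma> (alive (G (snd (hd h))) h), \<beta> * snd (last h))" for h
  show ?thesis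
    unfolding beta_absolute_winning_from_def
  proof (intro exI[of _ \<sigma>] conjI allI impI)
    show "legal_strategy \<beta> \<sigma>" using \<beta> by (auto simp: legal_strategy_def \<sigma>_def)
  next
    fix x r assume play: "bob_play J \<beta> \<sigma> x r"
    have \<sigma>_eq: "\<sigma> (map (\<lambda>k. (x k, r k)) [0..<Suc n]) =
        (median \<gamma> (alive (G (r 0)) (map (\<lambda>k. (x k, r k)) [0..<Suc n])), \<beta> * r n)" for n
    proof -
      have "hd (map (\<lambda>k. (x k, r k)) [0..<Suc n]) = (x 0, r 0)" by (simp add: hd_map del: upt_Suc)
      thus ?thesis unfolding \<sigma>_def by simp
    qed
    have moves: "r (Suc n) \<ge> \<beta> * r n \<and> cball (x (Suc n)) (r (Suc n)) \<subseteq> cball (x n) (r n) -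
       ball (median \<gamma> (alive (G (r 0)) (map (\<lambda>k. (x k, r k)) [0..<Suc n]))) (\<beta> * r n)" for n
      using play unfolding bob_play_def \<sigma>_eq by (auto simp del: upt_Suc)
    have start: "0 < r 0" "cball (x 0) (r 0) \<subseteq> J" using play by (auto simp: bob_play_def)
    interpret median_play "G (r 0)" \<beta> \<gamma> x r
    proof
      show "finite (G (r 0) u s)" for u s using finF by (simp add: G_def)
      show "0 < \<rho>" if "0 < s" "(z, \<rho>) \<in> G (r 0) u s" for u s z \<rho>
        using that \<mu> posF[OF start(1)] by (auto simp: G_def)
      show "(\<Sum>(z, \<rho>) \<in> G (r 0) u s. \<rho> powr \<gamma>) \<le> s powr \<gamma> / 6" if "0 < s" for u s
      proof -
        have "(\<Sum>(z, \<rho>) \<in> G (r 0) u s. \<rho> powr \<gamma>)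
            \<le> (\<mu> * s) powr \<gamma> + (\<Sum>(z, \<rho>) \<in> F (r 0) u s. \<rho> powr \<gamma>)"
          unfolding G_def using finF by (simp add: sum.insert_if)
        also have "\<dots> \<le> s powr \<gamma> / 12 + s powr \<gamma> / 12"
          using weightF[OF start(1) that, of u] powr_mult[of \<mu> s \<gamma>]
          unfolding \<mu>(2) by linarith
        finally show ?thesis by simp
      qed
    qed (use \<beta> \<gamma> \<beta>\<gamma> start moves in auto)
    have lim: "r \<longlonglongrightarrow> 0" by (rule radii_tendsto_zero[OF \<mu>(1)]) (simp add: G_def)
    obtain y where y: "\<And>n. y \<in> cball (x n) (r n)"
      using nested_balls_meet[of r x, OF r_pos balls_decrease] by fastforce
    have "y \<in> S"
    proof (rule target[OF start(2) r_pos _ lim y])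
      show "y \<notin> ball z \<rho>" if "(z, \<rho>) \<in> F (r 0) (x n) (r n)" for n z \<rho>
        using eventually_avoided[OF lim _ y] that by (auto simp: G_def)
    qed (use moves in auto)
    with y show "(\<Inter>n. cball (x n) (r n)) \<inter> S \<noteq> {}" by blast
  qed
qed

section \<open>Dangerous rational points and lines through them\<close>

definition dangerous ::
  "real \<Rightarrow> real \<Rightarrow> real \<Rightarrow> real \<Rightarrow> real \<Rightarrow> int \<Rightarrow> int \<Rightarrow> int \<Rightarrow> bool" where
  "dangerous i j \<theta> \<delta> y p s q \<longleftrightarrow> 1 \<le> q \<and>
     \<bar>of_int q * \<theta> - of_int p\<bar> * of_int q powr i \<le> \<delta> \<and>
     \<bar>of_int q * y - of_int s\<bar> * of_int q powr j \<le> \<delta>"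

definition line_through :: "real \<Rightarrow> real \<Rightarrow> int \<Rightarrow> int \<Rightarrow> int \<Rightarrow> int \<Rightarrow> int \<Rightarrow> int \<Rightarrow> bool" where
  "line_through i j p s q A B C \<longleftrightarrow> A * p + B * s + C * q = 0 \<and>
     \<bar>of_int A\<bar> \<le> of_int q powr i \<and> 1 \<le> B \<and> of_int B \<le> of_int q powr j"

text \<open>
  Compared with \<open>bad_pair\<close>, both exponents have been moved to \<open>q\<close>, so that one constant \<open>\<delta>\<close> serves both
  coordinates and the case \<open>i = 0\<close> needs no separate definition.
\<close>

definition avoiding :: "real \<Rightarrow> real \<Rightarrow> real \<Rightarrow> real set" where
  "avoiding i j \<theta> = {y. \<exists>\<delta>>0. \<forall>p s q. \<not> dangerous i j \<theta> \<delta> y p s q}"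

text \<open>
  There are more than \<open>q powr i * q powr j = q\<close> pairs \<open>(A, B)\<close> of natural numbers within the
  bounds, so \<open>A * p + B * s\<close> takes the same value modulo \<open>q\<close> at two of them.
\<close>

lemma exists_small_annihilator:
  fixes p s q :: int and i j :: real
  assumes q: "1 \<le> q" and ij: "i + j = 1"
  shows "\<exists>A B C. (A \<noteq> 0 \<or> B \<noteq> 0) \<and> A * p + B * s + C * q = 0 \<and>
     \<bar>real_of_int A\<bar> \<le> of_int q powr i \<and> \<bar>real_of_int B\<bar> \<le> of_int q powr j"
proof -
  define a b where "a = \<lfloor>of_int q powr i :: real\<rfloor>" and "b = \<lfloor>of_int q powr j :: real\<rfloor>"
  define f where "f = (\<lambda>(A, B). (A * p + B * s) mod q)"
  have ab: "0 \<le> a" "0 \<le> b" by (simp_all add: a_def b_def)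
  have "real_of_int q = of_int q powr i * of_int q powr j"
    using q ij by (simp add: powr_add[symmetric])
  also have "\<dots> < of_int (a + 1) * of_int (b + 1)"
    unfolding a_def b_def using q by (intro mult_strict_mono) (auto intro: add_nonneg_pos)
  also have "\<dots> = of_int ((a + 1) * (b + 1))" by simp
  finally have lt: "q < (a + 1) * (b + 1)" by linarith
  have "card (f ` ({0..a} \<times> {0..b})) \<le> card {0..<q}"
    using q by (intro card_mono) (auto simp: f_def)
  also have "\<dots> < card ({0..a} \<times> {0..b})"
  proof -
    have "int (nat q) < int (nat (a + 1) * nat (b + 1))" using q ab lt by simp
    hence "nat q < nat (a + 1) * nat (b + 1)" by (simp only: of_nat_less_iff)
    thus ?thesis by (simp add: card_cartesian_product add.commute)
  qed
  finally have "\<not> inj_on f ({0..a} \<times> {0..b})" by (rule pigeonhole)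
  then obtain A B A' B' where AB: "A \<in> {0..a}" "B \<in> {0..b}" "A' \<in> {0..a}" "B' \<in> {0..b}"
      "(A, B) \<noteq> (A', B')" "(A * p + B * s) mod q = (A' * p + B' * s) mod q"
    unfolding inj_on_def f_def by auto
  from AB(6) have "q dvd (A * p + B * s) - (A' * p + B' * s)" by (simp add: mod_eq_dvd_iff)
  then obtain C where C: "(A * p + B * s) - (A' * p + B' * s) = q * C" by auto
  have "of_int a \<le> (of_int q powr i :: real)" "of_int b \<le> (of_int q powr j :: real)"
    by (simp_all add: a_def b_def)
  moreover have "\<bar>A - A'\<bar> \<le> a" "\<bar>B - B'\<bar> \<le> b" using AB by auto
  hence "\<bar>real_of_int (A - A')\<bar> \<le> of_int a" "\<bar>real_of_int (B - B')\<bar> \<le> of_int b" by linarith+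
  moreover have "(A - A') * p + (B - B') * s + (- C) * q = 0"
    using C by (simp add: algebra_simps)
  ultimately show ?thesis using AB(5)
    by (intro exI[of _ "A - A'"] exI[of _ "B - B'"] exI[of _ "- C"]) auto
qed

text \<open>
  A vertical line \<open>A * x + C = 0\<close> through a rational point that is close to the line over \<open>\<theta>\<close> would
  make \<open>- C / A\<close> too good an approximation of \<open>\<theta>\<close>.
\<close>

lemma exists_line_through:
  fixes p s q :: int and i j \<theta> c :: real
  assumes i: "0 < i" and j: "0 \<le> j" and ij: "i + j = 1"
    and bad: "\<And>p q::int. 1 \<le> q \<Longrightarrow> c < of_int q powr (1 / i) * \<bar>of_int q * \<theta> - of_int p\<bar>"
    and q: "1 \<le> q" and close: "\<bar>of_int q * \<theta> - of_int p\<bar> * of_int q powr i \<le> c"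
  shows "\<exists>A B C. line_through i j p s q A B C"
proof -
  obtain A B C where ABC: "A \<noteq> 0 \<or> B \<noteq> 0" "A * p + B * s + C * q = 0"
      "\<bar>real_of_int A\<bar> \<le> of_int q powr i" "\<bar>real_of_int B\<bar> \<le> of_int q powr j"
    using exists_small_annihilator[OF q ij] by blast
  have "B \<noteq> 0"
  proof
    assume [simp]: "B = 0"
    hence A: "A \<noteq> 0" using ABC(1) by simp
    define u where "u = \<bar>real_of_int q * \<theta> - of_int p\<bar>"
    have "real_of_int (A * p + C * q) = 0" using ABC(2) by simp
    hence eq: "real_of_int q * (of_int A * \<theta> + of_int C) = of_int A * (of_int q * \<theta> - of_int p)"
      by (simp add: algebra_simps)
    have "\<bar>real_of_int A\<bar> powr (1 / i) \<le> (of_int q powr i) powr (1 / i)"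
      using ABC(3) i A by (intro powr_mono2) auto
    also have "\<dots> = of_int q" using i q by (simp add: powr_powr)
    finally have Aq: "\<bar>real_of_int A\<bar> powr (1 / i) \<le> of_int q" .
    have "c < \<bar>real_of_int A\<bar> powr (1 / i) * \<bar>of_int A * \<theta> + of_int C\<bar>"
    proof (cases "A > 0")
      case True
      thus ?thesis using bad[of A "- C"] by simp
    next
      case False
      hence "c < of_int (- A) powr (1 / i) * \<bar>of_int (- A) * \<theta> - of_int C\<bar>"
        using A by (intro bad) auto
      moreover have "\<bar>of_int (- A) * \<theta> - of_int C\<bar> = \<bar>of_int A * \<theta> + of_int C\<bar>" by auto
      ultimately show ?thesis using False by simp
    qed
    also have "\<dots> \<le> real_of_int q * \<bar>of_int A * \<theta> + of_int C\<bar>"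
      using Aq by (intro mult_right_mono) auto
    also have "\<dots> = \<bar>real_of_int q * (of_int A * \<theta> + of_int C)\<bar>" using q by (simp add: abs_mult)
    also have "\<dots> = \<bar>real_of_int A\<bar> * u" unfolding eq u_def by (simp add: abs_mult)
    also have "\<dots> \<le> of_int q powr i * u" using ABC(3) by (intro mult_right_mono) (auto simp: u_def)
    also have "\<dots> \<le> c" using close by (simp add: u_def mult.commute)
    finally show False by simp
  qed
  show ?thesis
  proof (cases "B > 0")
    case True
    then show ?thesis using ABC unfolding line_through_def by (intro exI[of _ A] exI[of _ B] exI[of _ C]) auto
  next
    case False
    have "(- A) * p + (- B) * s + (- C) * q = 0" using ABC(2) by (simp add: algebra_simps)
    then show ?thesis using ABC False \<open>B \<noteq> 0\<close> unfolding line_through_def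
      by (intro exI[of _ "- A"] exI[of _ "- B"] exI[of _ "- C"]) auto
  qed
qed

lemma form_decomposition:
  fixes A B C p s q :: int and \<theta> y :: real
  shows "of_int q * (of_int A * \<theta> + of_int B * y + of_int C) =
    of_int (A * p + B * s + C * q) + of_int A * (of_int q * \<theta> - of_int p)
      + of_int B * (of_int q * y - of_int s)"
  by (simp add: algebra_simps)

text \<open>
  With \<open>A * p + B * s + C * q = 0\<close> this bounds the linear form of a line at \<open>(\<theta>, y)\<close>.  The
  factor \<open>R\<close> allows the coefficients to come from another point of comparable height.
\<close>

lemma form_error:
  fixes A B p s q :: int and \<theta> y a b R \<delta> :: real
  assumes "\<bar>of_int A\<bar> \<le> R * a" "\<bar>of_int B\<bar> \<le> R * b" "0 \<le> R"
    and "\<bar>of_int q * \<theta> - of_int p\<bar> * a \<le> \<delta>" "\<bar>of_int q * y - of_int s\<bar> * b \<le> \<delta>"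
  shows "\<bar>of_int A * (of_int q * \<theta> - of_int p) + of_int B * (of_int q * y - of_int s)\<bar> \<le> 2 * R * \<delta>"
proof -
  have "\<bar>real_of_int A\<bar> * \<bar>of_int q * \<theta> - of_int p\<bar> \<le> (R * a) * \<bar>of_int q * \<theta> - of_int p\<bar>"
    using assms by (intro mult_right_mono) auto
  also have "\<dots> = R * (\<bar>of_int q * \<theta> - of_int p\<bar> * a)" by simp
  also have "\<dots> \<le> R * \<delta>" using assms by (intro mult_left_mono) auto
  finally have 1: "\<bar>of_int A * (of_int q * \<theta> - of_int p)\<bar> \<le> R * \<delta>" by (simp add: abs_mult)
  have "\<bar>real_of_int B\<bar> * \<bar>of_int q * y - of_int s\<bar> \<le> (R * b) * \<bar>of_int q * y - of_int s\<bar>"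
    using assms by (intro mult_right_mono) auto
  also have "\<dots> = R * (\<bar>of_int q * y - of_int s\<bar> * b)" by simp
  also have "\<dots> \<le> R * \<delta>" using assms by (intro mult_left_mono) auto
  finally have 2: "\<bar>of_int B * (of_int q * y - of_int s)\<bar> \<le> R * \<delta>" by (simp add: abs_mult)
  from 1 2 show ?thesis by linarith
qed

lemma dangerous_form_small:
  assumes "line_through i j p s q A B C" "dangerous i j \<theta> \<delta> y p s q"
  shows "of_int q * \<bar>of_int A * \<theta> + of_int B * y + of_int C\<bar> \<le> 2 * \<delta>"
proof -
  have "of_int q * \<bar>of_int A * \<theta> + of_int B * y + of_int C\<bar>
      = \<bar>of_int q * (of_int A * \<theta> + of_int B * y + of_int C)\<bar>"
    using assms(2) by (simp add: abs_mult dangerous_def)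
  also have "\<dots> \<le> 2 * 1 * \<delta>"
    unfolding form_decomposition[of q A \<theta> B y C p s]
    using form_error[of A 1 "of_int q powr i" B "of_int q powr j" q \<theta> p \<delta> y s] assms
    by (simp add: line_through_def dangerous_def)
  finally show ?thesis by simp
qed

section \<open>Dangerous points of the same class\<close>

text \<open>
  The parameters stand for \<open>e = 2 ^ (-k)\<close> and \<open>X = 2 powr (j * k / 3)\<close>, that is, \<open>X = e powr (- j / 3)\<close>: the
  first line says that \<open>B\<close> is smaller than \<open>q powr j\<close> by about the factor \<open>e\<close>, the second that the class is due
  at radius \<open>r\<close>.  Classes with small \<open>e\<close> are due while Bob's ball is still large, hence \<open>X\<close>.
\<close>

definition in_class :: "real \<Rightarrow> real \<Rightarrow> real \<Rightarrow> real \<Rightarrow> real \<Rightarrow> real \<Rightarrow> int \<Rightarrow> int \<Rightarrow> bool" where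
  "in_class j \<beta> T e r X q B \<longleftrightarrow>
     e / 2 * of_int q powr j < of_int B \<and> of_int B \<le> e * of_int q powr j \<and>
     \<beta> * T * X \<le> of_int q * of_int B * r \<and> of_int q * of_int B * r \<le> 2 * T * X"

text \<open>
  A class determines \<open>q * B\<close> up to the factor \<open>2 / \<beta>\<close> and \<open>B / q powr j\<close> up to the factor \<open>2\<close>, hence their
  quotient \<open>q powr (1 + j)\<close> up to the factor \<open>4 / \<beta>\<close>.
\<close>

lemma class_comparable:
  assumes "in_class j \<beta> T e r X q1 B1" "in_class j \<beta> T e r X q2 B2"
    and "1 \<le> q1" "1 \<le> q2" "0 < \<beta>" "\<beta> \<le> 1" "0 < e" "0 < r" "0 < j"
  shows "real_of_int q1 \<le> 4 / \<beta> * of_int q2"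
proof -
  define c1 c2 :: real where "c1 = of_int q1 powr j" and "c2 = of_int q2 powr j"
  have 1: "e / 2 * c1 < of_int B1" "of_int B2 \<le> e * c2"
      "\<beta> * T * X \<le> of_int q2 * of_int B2 * r" "of_int q1 * of_int B1 * r \<le> 2 * T * X"
    using assms(1,2) by (auto simp: in_class_def c1_def c2_def)
  have "(e * r) * (\<beta> * (of_int q1 * c1)) = 2 * \<beta> * r * of_int q1 * (e / 2 * c1)" by simp
  also have "\<dots> \<le> 2 * \<beta> * r * of_int q1 * of_int B1"
    using 1(1) assms by (intro mult_left_mono) auto
  also have "\<dots> = 2 * \<beta> * (of_int q1 * of_int B1 * r)" by simp
  also have "\<dots> \<le> 2 * \<beta> * (2 * T * X)" using 1(4) assms by (intro mult_left_mono) auto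
  also have "\<dots> = 4 * (\<beta> * T * X)" by simp
  also have "\<dots> \<le> 4 * (of_int q2 * of_int B2 * r)" using 1(3) by simp
  also have "\<dots> = 4 * of_int q2 * r * of_int B2" by simp
  also have "\<dots> \<le> 4 * of_int q2 * r * (e * c2)"
    using 1(2) assms by (intro mult_left_mono) auto
  also have "\<dots> = (e * r) * (4 * (of_int q2 * c2))" by simp
  finally have "\<beta> * (of_int q1 * c1) \<le> 4 * (of_int q2 * c2)" using assms by simp
  hence "of_int q1 * c1 \<le> 4 / \<beta> * (of_int q2 * c2)" using assms by (simp add: field_simps)
  moreover have "of_int q1 * c1 = real_of_int q1 powr (1 + j)" "of_int q2 * c2 = real_of_int q2 powr (1 + j)"
    using assms by (simp_all add: powr_add c1_def c2_def)
  moreover have "4 / \<beta> \<le> (4 / \<beta>) powr (1 + j)"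
    using powr_mono[of 1 "1 + j" "4 / \<beta>"] assms by (simp add: field_simps)
  ultimately have "real_of_int q1 powr (1 + j) \<le> (4 / \<beta>) powr (1 + j) * real_of_int q2 powr (1 + j)"
    by (smt (verit) mult_right_mono powr_ge_zero)
  also have "\<dots> = (4 / \<beta> * of_int q2) powr (1 + j)" using assms by (subst powr_mult) auto
  finally show ?thesis
    using powr_less_mono2[of "1 + j" "4 / \<beta> * of_int q2" "of_int q1"] assms
    by (smt (verit) divide_nonneg_nonneg mult_nonneg_nonneg of_int_nonneg)
qed

lemma powr_le_mult_powr:
  fixes u v R t :: real
  assumes "0 < u" "0 < v" "u \<le> R * v" "1 \<le> R" "0 \<le> t" "t \<le> 1"
  shows "u powr t \<le> R * v powr t"
proof -
  have "u powr t \<le> (R * v) powr t" using assms by (intro powr_mono2) auto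
  also have "\<dots> = R powr t * v powr t" using assms by (subst powr_mult) auto
  also have "\<dots> \<le> R * v powr t"
    using powr_mono[of t 1 R] assms by (intro mult_right_mono) auto
  finally show ?thesis .
qed

lemma no_smaller_danger:
  assumes minimal: "\<And>p s q. dangerous i j \<theta> \<delta> y p s q \<Longrightarrow> Q \<le> q"
    and "q \<noteq> 0" "\<bar>q\<bar> < Q"
    and "\<bar>of_int q * \<theta> - of_int p\<bar> * \<bar>real_of_int q\<bar> powr i \<le> \<delta>"
    and "\<bar>of_int q * y - of_int s\<bar> * \<bar>real_of_int q\<bar> powr j \<le> \<delta>"
  shows False
proof (cases "q > 0")
  case True
  hence "dangerous i j \<theta> \<delta> y p s q" using assms(4,5) by (simp add: dangerous_def)
  from minimal[OF this] assms(3) show False by linarith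
next
  case False
  hence "\<bar>real_of_int q\<bar> = of_int (- q)" by simp
  moreover have "\<bar>of_int (- q) * \<theta> - of_int (- p)\<bar> = \<bar>of_int q * \<theta> - of_int p\<bar>"
      "\<bar>of_int (- q) * y - of_int (- s)\<bar> = \<bar>of_int q * y - of_int s\<bar>" by auto
  ultimately have "dangerous i j \<theta> \<delta> y (- p) (- s) (- q)"
    using assms(2,4,5) False unfolding dangerous_def by simp
  from minimal[OF this] assms(3) show False by linarith
qed

lemma abs_diff_mult_le: "\<bar>a * b - c * d\<bar> \<le> \<bar>a\<bar> * \<bar>b\<bar> + \<bar>c\<bar> * \<bar>d\<bar>" for a b c d :: real
  using abs_triangle_ineq4[of "a * b" "c * d"] by (simp add: abs_mult)

text \<open>
  The heart of the proof.  Let \<open>F\<^sub>l = A\<^sub>l * \<theta> + B\<^sub>l * y + C\<^sub>l\<close>; both \<open>q\<^sub>l * \<bar>F\<^sub>l\<bar>\<close> are at most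
  \<open>M = 6 * T * X\<close>.  If \<open>X\<close> is small, \<open>F\<^sub>1\<close> is so small that \<open>(p2, s2, q2)\<close>
  lies on the first line.  If \<open>X\<close> is large, hence \<open>e = X powr (- 3 / j)\<close> very small, the cross product
  \<open>(p0, s0, q0)\<close> of the two coefficient vectors is dangerous for \<open>y\<close> unless \<open>q0 = 0\<close>.  The exponent
  \<open>3\<close> in \<open>e powr j * X ^ 3 = 1\<close> and the choice \<open>\<delta> = T\<^sup>2\<close> are made for this: the approximation of \<open>y\<close> by
  \<open>s0 / q0\<close> has error constant at most \<open>D\<^sup>2 * M * e powr j = 6 * D\<^sup>2 * T / X\<^sup>2\<close>, which for \<open>X > 1 / (6 * D * T)\<close> is
  of order \<open>T ^ 3\<close>, below \<open>\<delta>\<close>, while the resulting interval has radius of order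
  \<open>\<delta> / T * (r / X)\<close>, still small in comparison with \<open>r\<close>.
\<close>

lemma class_shares_crossing:
  fixes p1 s1 q1 A1 B1 C1 p2 s2 q2 A2 B2 C2 :: int
  assumes ij: "0 \<le> i" "0 < j" "i + j = 1"
    and \<beta>: "0 < \<beta>" "\<beta> \<le> 1" and T: "0 < T" "216 * (8 / \<beta>) ^ 4 * T \<le> 1"
    and e: "0 < e" "e \<le> 1" and X: "1 \<le> X" "e powr j * X ^ 3 = 1" and r: "0 < r"
    and line1: "line_through i j p1 s1 q1 A1 B1 C1" and line2: "line_through i j p2 s2 q2 A2 B2 C2"
    and dang1: "dangerous i j \<theta> (T\<^sup>2) y1 p1 s1 q1" and dang2: "dangerous i j \<theta> (T\<^sup>2) y p2 s2 q2"
    and class1: "in_class j \<beta> T e r X q1 B1" and class2: "in_class j \<beta> T e r X q2 B2"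
    and y1: "\<bar>y - y1\<bar> \<le> 2 * r"
    and minimal: "\<And>p s q. dangerous i j \<theta> (T\<^sup>2) y p s q \<Longrightarrow> q2 \<le> q"
  shows "\<bar>y - (- (of_int A1 * \<theta> + of_int C1) / of_int B1)\<bar> \<le> 2 * (4 / \<beta>)\<^sup>2 * T / \<beta> * (r / X)"
proof -
  define R D :: real where "R = 4 / \<beta>" and "D = 2 * R"
  define a1 b1 a2 b2 :: real where "a1 = of_int q1 powr i" and "b1 = of_int q1 powr j"
    and "a2 = of_int q2 powr i" and "b2 = of_int q2 powr j"
  define F1 F2 where "F1 = of_int A1 * \<theta> + of_int B1 * y + of_int C1"
    and "F2 = of_int A2 * \<theta> + of_int B2 * y + of_int C2"
  have R: "4 \<le> R" using \<beta> by (simp add: R_def field_simps)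
  have D: "8 \<le> D" using R by (simp add: D_def)
  have TD: "216 * D ^ 4 * T \<le> 1" using T(2) by (simp add: D_def R_def)
  have D4: "4096 \<le> D ^ 4" using power_mono[OF D, of 4] by simp
  have "216 * 4096 * T \<le> 216 * D ^ 4 * T" using D4 T(1) by (intro mult_right_mono) auto
  hence T1: "T \<le> 1 / 1000" using TD by linarith
  have q: "1 \<le> q1" "1 \<le> q2" using dang1 dang2 by (auto simp: dangerous_def)
  have i1: "i \<le> 1" "j \<le> 1" using ij by auto
  have prod: "a1 * b1 = of_int q1" "a2 * b2 = of_int q2"
    using q ij(3) by (simp_all add: a1_def b1_def a2_def b2_def powr_add[symmetric])
  have ge1: "1 \<le> a1" "1 \<le> b1" "1 \<le> a2" "1 \<le> b2"
    using q ij by (simp_all add: a1_def b1_def a2_def b2_def ge_one_powr_ge_zero)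
  have q12: "of_int q1 \<le> R * of_int q2" and q21: "of_int q2 \<le> R * of_int q1"
    using class_comparable[OF class1 class2 q \<beta> e(1) r ij(2)]
      class_comparable[OF class2 class1 q(2,1) \<beta> e(1) r ij(2)] by (simp_all add: R_def)
  have cmp: "a1 \<le> R * a2" "b1 \<le> R * b2" "a2 \<le> R * a1" "b2 \<le> R * b1"
  proof -
    have pos: "0 < real_of_int q1" "0 < real_of_int q2" "1 \<le> R" using q R by auto
    show "a1 \<le> R * a2" "b1 \<le> R * b2" "a2 \<le> R * a1" "b2 \<le> R * b1"
      unfolding a1_def a2_def b1_def b2_def
      by (rule powr_le_mult_powr[OF pos(1,2) q12 pos(3)] powr_le_mult_powr[OF pos(2,1) q21 pos(3)];
          use ij i1 in linarith)+
  qed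
  have A: "\<bar>real_of_int A1\<bar> \<le> a1" "\<bar>real_of_int A2\<bar> \<le> a2"
    and B: "0 < real_of_int B1" "0 < real_of_int B2" and Bb: "of_int B1 \<le> b1"
      "of_int B2 \<le> b2"
    and Be: "of_int B1 \<le> e * b1" "of_int B2 \<le> e * b2" "1 \<le> real_of_int B2"
    using line1 line2 class1 class2
    by (auto simp: line_through_def in_class_def a1_def a2_def b1_def b2_def)
  have qB: "\<beta> * T * X \<le> of_int q1 * of_int B1 * r" "of_int q1 * of_int B1 * r \<le> 2 * T * X"
      "\<beta> * T * X \<le> of_int q2 * of_int B2 * r"
    using class1 class2 by (auto simp: in_class_def)
  have TX: "T \<le> T * X" using T X mult_left_mono[of 1 X T] by simp
  have T2: "T\<^sup>2 \<le> T" using T T1 by (simp add: power2_eq_square mult_left_le)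
  define M where "M = 6 * T * X"
  have F2: "of_int q2 * \<bar>F2\<bar> \<le> 2 * T\<^sup>2" unfolding F2_def by (rule dangerous_form_small[OF line2 dang2])
  hence F2M: "of_int q2 * \<bar>F2\<bar> \<le> M" using T2 TX T unfolding M_def by linarith
  have F1M: "of_int q1 * \<bar>F1\<bar> \<le> M"
  proof -
    have "F1 = (of_int A1 * \<theta> + of_int B1 * y1 + of_int C1) + of_int B1 * (y - y1)"
      by (simp add: F1_def algebra_simps)
    hence "\<bar>F1\<bar> \<le> \<bar>of_int A1 * \<theta> + of_int B1 * y1 + of_int C1\<bar> + of_int B1 * \<bar>y - y1\<bar>"
      using B(1) abs_triangle_ineq[of "of_int A1 * \<theta> + of_int B1 * y1 + of_int C1" "of_int B1 * (y - y1)"]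
      by (simp add: abs_mult)
    also have "\<dots> \<le> \<bar>of_int A1 * \<theta> + of_int B1 * y1 + of_int C1\<bar> + of_int B1 * (2 * r)"
      using y1 B by (intro add_left_mono mult_left_mono) auto
    finally have "of_int q1 * \<bar>F1\<bar> \<le>
        of_int q1 * (\<bar>of_int A1 * \<theta> + of_int B1 * y1 + of_int C1\<bar> + of_int B1 * (2 * r))"
      using q by (intro mult_left_mono) auto
    also have "\<dots> = of_int q1 * \<bar>of_int A1 * \<theta> + of_int B1 * y1 + of_int C1\<bar>
        + 2 * (of_int q1 * of_int B1 * r)" by (simp add: algebra_simps)
    also have "\<dots> \<le> 2 * T\<^sup>2 + 2 * (2 * T * X)"
      using dangerous_form_small[OF line1 dang1] qB(2) by linarith
    also have "\<dots> \<le> M" using T2 TX unfolding M_def by linarith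
    finally show ?thesis .
  qed
  have crossing: "\<bar>y - (- (of_int A1 * \<theta> + of_int C1) / of_int B1)\<bar> = \<bar>F1\<bar> / of_int B1"
  proof -
    have "y - (- (of_int A1 * \<theta> + of_int C1) / of_int B1) = F1 / of_int B1"
      using B by (simp add: F1_def field_simps)
    thus ?thesis using B by simp
  qed
  have bound: "f / b \<le> 2 * (4 / \<beta>)\<^sup>2 * T / \<beta> * (r / X)"
    if "q' * f \<le> 2 * R\<^sup>2 * T\<^sup>2" "\<beta> * T * X \<le> q' * b * r" "0 < q'" "0 < b" for q' f b :: real
  proof -
    have "f / b = (q' * f) / (q' * b)" using that by simp
    also have "\<dots> \<le> (2 * R\<^sup>2 * T\<^sup>2) / (q' * b)" using that by (intro divide_right_mono) auto
    also have "\<dots> \<le> (2 * R\<^sup>2 * T\<^sup>2) / (\<beta> * T * X / r)"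
      using that r \<beta> T X by (intro divide_left_mono) (auto simp: field_simps)
    also have "\<dots> = 2 * (4 / \<beta>)\<^sup>2 * T / \<beta> * (r / X)"
      using r \<beta> T X by (simp add: R_def power2_eq_square field_simps)
    finally show ?thesis .
  qed
  show ?thesis
  proof (cases "2 * R * M \<le> 1")
    case True
    \<comment> \<open>the first linear form at the second point is an integer of absolute value below \<open>1\<close>\<close>
    have err: "\<bar>of_int A1 * (of_int q2 * \<theta> - of_int p2) + of_int B1 * (of_int q2 * y - of_int s2)\<bar>
        \<le> 2 * R * T\<^sup>2"
      using A(1) Bb(1) B(1) cmp R dang2
      by (intro form_error[where a = a2 and b = b2]) (auto simp: dangerous_def a2_def b2_def)
    have "of_int q2 * \<bar>F1\<bar> \<le> R * of_int q1 * \<bar>F1\<bar>" using q21 by (intro mult_right_mono) auto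
    also have "\<dots> \<le> R * M" using F1M R by (simp add: mult.assoc)
    finally have qF: "of_int q2 * \<bar>F1\<bar> \<le> 1 / 2" using True by linarith
    have "2 * R * T\<^sup>2 < 1 / 2"
    proof -
      have "2 * R * T\<^sup>2 \<le> 2 * R * T" using T2 R by (intro mult_left_mono) auto
      also have "\<dots> \<le> D ^ 4 * T"
        using T D power_increasing[of 1 4 D] by (intro mult_right_mono) (auto simp: D_def)
      finally show ?thesis using TD T by (simp)
    qed
    moreover have eq: "real_of_int q2 * F1 = of_int (A1 * p2 + B1 * s2 + C1 * q2)
        + (of_int A1 * (of_int q2 * \<theta> - of_int p2) + of_int B1 * (of_int q2 * y - of_int s2))"
      unfolding F1_def by (simp add: algebra_simps)
    moreover have absq: "of_int q2 * \<bar>F1\<bar> = \<bar>real_of_int q2 * F1\<bar>" using q by (simp add: abs_mult)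
    ultimately have "\<bar>real_of_int (A1 * p2 + B1 * s2 + C1 * q2)\<bar> < 1"
      using err qF by linarith
    hence "A1 * p2 + B1 * s2 + C1 * q2 = 0" by linarith
    hence "of_int q2 * \<bar>F1\<bar> \<le> 2 * R * T\<^sup>2" using err eq absq by simp
    hence "R * (of_int q2 * \<bar>F1\<bar>) \<le> R * (2 * R * T\<^sup>2)" using R by (intro mult_left_mono) auto
    moreover have "of_int q1 * \<bar>F1\<bar> \<le> R * of_int q2 * \<bar>F1\<bar>" using q12 by (intro mult_right_mono) auto
    ultimately have "of_int q1 * \<bar>F1\<bar> \<le> 2 * R\<^sup>2 * T\<^sup>2" by (simp add: power2_eq_square)
    from bound[OF this qB(1)] show ?thesis unfolding crossing using q B by simp
  next
    case False
    \<comment> \<open>the intersection of the two lines in homogeneous coordinates, up to sign\<close>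
    define p0 s0 q0 where "p0 = B1 * C2 - B2 * C1" and "s0 = C1 * A2 - C2 * A1"
      and "q0 = A1 * B2 - A2 * B1"
    have eqp: "of_int q0 * \<theta> - of_int p0 = of_int B2 * F1 - of_int B1 * F2"
      and eqs: "of_int q0 * y - of_int s0 = of_int A1 * F2 - of_int A2 * F1"
      by (simp_all add: p0_def q0_def s0_def F1_def F2_def algebra_simps)
    have Xbig: "1 < 6 * D * T * X" using False by (simp add: M_def D_def)
    have small: "D\<^sup>2 * M * e powr j \<le> T\<^sup>2" "D * e < 1"
    proof -
      have ej: "e powr j = 1 / X ^ 3" using X by (simp add: field_simps)
      have "1 / X < 6 * D * T" using Xbig X by (simp add: field_simps)
      hence inv: "(1 / X) ^ n \<le> (6 * D * T) ^ n" for n using X by (intro power_mono) auto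
      have T3: "216 * D ^ 4 * T ^ 3 \<le> T\<^sup>2"
      proof -
        have "216 * D ^ 4 * T ^ 3 = (216 * D ^ 4 * T) * T\<^sup>2" by (simp add: power2_eq_square power3_eq_cube)
        also have "\<dots> \<le> 1 * T\<^sup>2" using TD by (intro mult_right_mono) auto
        finally show ?thesis by simp
      qed
      have "D\<^sup>2 * M * e powr j = 6 * D\<^sup>2 * T * (1 / X) ^ 2"
        using X by (simp add: ej M_def power2_eq_square power3_eq_cube field_simps)
      also have "\<dots> \<le> 6 * D\<^sup>2 * T * (6 * D * T) ^ 2"
        using inv[of 2] T D by (intro mult_left_mono) auto
      also have "\<dots> = 216 * D ^ 4 * T ^ 3" by (simp add: power2_eq_square power3_eq_cube power4_eq_xxxx)
      finally show "D\<^sup>2 * M * e powr j \<le> T\<^sup>2" using T3 by linarith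
      have "e \<le> e powr j" using powr_mono'[of j 1 e] e i1 by simp
      hence "D * e \<le> D * (1 / X) ^ 3"
        unfolding ej using D by (intro mult_left_mono) (auto simp: power_divide)
      also have "\<dots> \<le> D * (6 * D * T) ^ 3" using inv[of 3] D by (intro mult_left_mono) auto
      also have "\<dots> = 216 * D ^ 4 * T ^ 3" by (simp add: power3_eq_cube power4_eq_xxxx)
      finally have "D * e \<le> T" using T3 T2 by linarith
      thus "D * e < 1" using T1 by linarith
    qed
    have Mpos: "0 < M" using T X by (simp add: M_def)
    have a12: "a1 * b2 \<le> R * of_int q2" "a2 * b1 \<le> R * of_int q2"
      using cmp(1,2) ge1 mult_right_mono[of a1 "R * a2" b2] mult_left_mono[of b1 "R * b2" a2]
      unfolding prod(2)[symmetric] by (auto simp: mult_ac)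
    have q0_le: "\<bar>real_of_int q0\<bar> \<le> D * e * of_int q2"
    proof -
      have "\<bar>real_of_int q0\<bar> \<le> \<bar>real_of_int A1\<bar> * of_int B2 + \<bar>real_of_int A2\<bar> * of_int B1"
        using abs_diff_mult_le[of "of_int A1" "of_int B2" "of_int A2" "of_int B1"] B
        by (simp add: q0_def)
      also have "\<dots> \<le> a1 * (e * b2) + a2 * (e * b1)"
        using A B Be ge1 by (intro add_mono mult_mono) auto
      also have "\<dots> = e * (a1 * b2 + a2 * b1)" by (simp add: algebra_simps)
      also have "\<dots> \<le> e * (R * of_int q2 + R * of_int q2)"
        using a12 e by (intro mult_left_mono add_mono) auto
      finally show ?thesis by (simp add: D_def algebra_simps)
    qed
    have f1: "\<bar>F1\<bar> \<le> M / of_int q1" and f2: "\<bar>F2\<bar> \<le> M / of_int q2"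
      using F1M F2M q by (simp_all add: field_simps)
    have p0_le: "\<bar>of_int q0 * \<theta> - of_int p0\<bar> * a2 \<le> D * M * e"
    proof -
      have "\<bar>of_int q0 * \<theta> - of_int p0\<bar> \<le> of_int B2 * \<bar>F1\<bar> + of_int B1 * \<bar>F2\<bar>"
        unfolding eqp using abs_diff_mult_le[of "of_int B2" F1 "of_int B1" F2] B by simp
      also have "\<dots> \<le> (e * b2) * (M / of_int q1) + (e * b1) * (M / of_int q2)"
        using f1 f2 Be B e ge1 by (intro add_mono mult_mono) auto
      finally have "\<bar>of_int q0 * \<theta> - of_int p0\<bar> * a2
          \<le> ((e * b2) * (M / of_int q1) + (e * b1) * (M / of_int q2)) * a2"
        using ge1 by (intro mult_right_mono) auto
      also have "\<dots> = e * M * (a2 * b2 / of_int q1 + a2 * b1 / of_int q2)" by (simp add: algebra_simps)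
      also have "\<dots> \<le> e * M * (R + R)"
        using q21 a12(2) q e Mpos unfolding prod by (intro mult_left_mono add_mono) (auto simp: field_simps)
      finally show ?thesis by (simp add: D_def algebra_simps)
    qed
    have s0_le: "\<bar>of_int q0 * y - of_int s0\<bar> * b2 \<le> D * M"
    proof -
      have "\<bar>of_int q0 * y - of_int s0\<bar> \<le> \<bar>of_int A1\<bar> * \<bar>F2\<bar> + \<bar>of_int A2\<bar> * \<bar>F1\<bar>"
        unfolding eqs by (rule abs_diff_mult_le)
      also have "\<dots> \<le> a1 * (M / of_int q2) + a2 * (M / of_int q1)"
        using f1 f2 A ge1 by (intro add_mono mult_mono) auto
      finally have "\<bar>of_int q0 * y - of_int s0\<bar> * b2
          \<le> (a1 * (M / of_int q2) + a2 * (M / of_int q1)) * b2"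
        using ge1 by (intro mult_right_mono) auto
      also have "\<dots> = M * (a1 * b2 / of_int q2 + a2 * b2 / of_int q1)" by (simp add: algebra_simps)
      also have "\<dots> \<le> M * (R + R)"
        using q21 a12(1) q Mpos unfolding prod by (intro mult_left_mono add_mono) (auto simp: field_simps)
      finally show ?thesis by (simp add: D_def algebra_simps)
    qed
    have De: "D * M * e \<le> T\<^sup>2"
    proof -
      have "D * M * e \<le> D\<^sup>2 * M * e powr j"
        using powr_mono'[of j 1 e] e i1 D Mpos power_increasing[of 1 2 D]
        by (intro mult_mono) auto
      with small(1) show ?thesis by linarith
    qed
    have q0: "q0 = 0"
    proof (rule ccontr)
      assume "q0 \<noteq> 0"
      have powr_q0: "\<bar>real_of_int q0\<bar> powr t \<le> (D * e) powr t * of_int q2 powr t" if "0 \<le> t" for t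
        using powr_mono2[OF that _ q0_le] D e q by (simp add: powr_mult)
      have "\<bar>real_of_int q0\<bar> powr i \<le> a2"
      proof -
        have "(D * e) powr i \<le> 1" using small(2) D e ij(1) by (intro powr_le1) auto
        thus ?thesis using powr_q0[OF ij(1)] ge1(3) mult_right_mono[of "(D * e) powr i" 1 a2]
          unfolding a2_def by linarith
      qed
      hence "\<bar>of_int q0 * \<theta> - of_int p0\<bar> * \<bar>real_of_int q0\<bar> powr i
          \<le> \<bar>of_int q0 * \<theta> - of_int p0\<bar> * a2" by (intro mult_left_mono) auto
      hence 1: "\<bar>of_int q0 * \<theta> - of_int p0\<bar> * \<bar>real_of_int q0\<bar> powr i \<le> T\<^sup>2"
        using p0_le De by linarith
      have "\<bar>real_of_int q0\<bar> powr j \<le> D * e powr j * b2"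
      proof -
        have "(D * e) powr j \<le> D * e powr j"
          using powr_mono[of j 1 D] i1 D e by (simp add: powr_mult mult_right_mono)
        hence "(D * e) powr j * b2 \<le> D * e powr j * b2" using ge1 by (intro mult_right_mono) auto
        thus ?thesis using powr_q0[of j] ij unfolding b2_def by linarith
      qed
      hence "\<bar>of_int q0 * y - of_int s0\<bar> * \<bar>real_of_int q0\<bar> powr j
          \<le> \<bar>of_int q0 * y - of_int s0\<bar> * (D * e powr j * b2)" by (intro mult_left_mono) auto
      also have "\<dots> = (\<bar>of_int q0 * y - of_int s0\<bar> * b2) * (D * e powr j)" by simp
      also have "\<dots> \<le> D * M * (D * e powr j)" using s0_le D by (intro mult_right_mono) auto
      also have "\<dots> \<le> T\<^sup>2" using small(1) by (simp add: power2_eq_square mult_ac)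
      finally have 2: "\<bar>of_int q0 * y - of_int s0\<bar> * \<bar>real_of_int q0\<bar> powr j \<le> T\<^sup>2" .
      have "D * e * of_int q2 < 1 * real_of_int q2" using small(2) q by (intro mult_strict_right_mono) auto
      hence "\<bar>q0\<bar> < q2" using q0_le by linarith
      from no_smaller_danger[OF minimal \<open>q0 \<noteq> 0\<close> this 1 2] show False .
    qed
    \<comment> \<open>Parallel lines: the same estimate now bounds the integer \<open>p0\<close> by \<open>T\<^sup>2 < 1\<close>.\<close>
    have "\<bar>real_of_int p0\<bar> * a2 < 1" using p0_le De q0 T1 T2 by simp
    hence "\<bar>real_of_int p0\<bar> < 1" using ge1(3) mult_left_mono[of 1 a2 "\<bar>real_of_int p0\<bar>"] by simp
    hence "p0 = 0" by linarith
    hence "of_int B2 * F1 = of_int B1 * F2" using eqp q0 by simp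
    hence "\<bar>of_int B2 * F1\<bar> = \<bar>of_int B1 * F2\<bar>" by simp
    hence "\<bar>F1\<bar> / of_int B1 = \<bar>F2\<bar> / of_int B2"
      using B by (simp add: abs_mult field_simps)
    moreover have "of_int q2 * \<bar>F2\<bar> \<le> 2 * R\<^sup>2 * T\<^sup>2"
    proof -
      have "1 * T\<^sup>2 \<le> R\<^sup>2 * T\<^sup>2" using R by (intro mult_right_mono) auto
      thus ?thesis using F2 by linarith
    qed
    ultimately show ?thesis using bound[OF _ qB(3)] q B unfolding crossing by simp
  qed
qed

section \<open>The cover and the fibres of Bad\<close>

text \<open>
  If some point of the class endangers a point of the ball, the crossing of its line serves as the
  centre for the whole class.
\<close>

lemma class_interval:
  assumes "0 \<le> i" "0 < j" "i + j = 1" "0 < \<beta>" "\<beta> \<le> 1" "0 < T" "216 * (8 / \<beta>) ^ 4 * T \<le> 1"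
    and "0 < e" "e \<le> 1" "1 \<le> X" "e powr j * X ^ 3 = 1" "0 < r"
  shows "\<exists>z. \<forall>y\<in>cball x r. \<forall>p s q A B C. line_through i j p s q A B C \<longrightarrow>
     dangerous i j \<theta> (T\<^sup>2) y p s q \<longrightarrow> in_class j \<beta> T e r X q B \<longrightarrow>
     (\<forall>p' s' q'. dangerous i j \<theta> (T\<^sup>2) y p' s' q' \<longrightarrow> q \<le> q') \<longrightarrow>
     \<bar>y - z\<bar> \<le> 2 * (4 / \<beta>)\<^sup>2 * T / \<beta> * (r / X)"
proof (cases "\<exists>y1\<in>cball x r. \<exists>p1 s1 q1 A1 B1 C1. line_through i j p1 s1 q1 A1 B1 C1 \<and>
    dangerous i j \<theta> (T\<^sup>2) y1 p1 s1 q1 \<and> in_class j \<beta> T e r X q1 B1")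
  case True
  then obtain y1 p1 s1 q1 A1 B1 C1 where 1: "y1 \<in> cball x r" "line_through i j p1 s1 q1 A1 B1 C1"
      "dangerous i j \<theta> (T\<^sup>2) y1 p1 s1 q1" "in_class j \<beta> T e r X q1 B1"
    by blast
  have diam: "\<bar>y - y1\<bar> \<le> 2 * r" if "y \<in> cball x r" for y
    using that 1(1) by (simp add: dist_real_def)
  show ?thesis
    by (intro exI[of _ "- (of_int A1 * \<theta> + of_int C1) / of_int B1"] ballI allI impI)
      (rule class_shares_crossing[OF assms 1(2) _ 1(3) _ 1(4)]; (assumption | blast intro: diam))
next
  case False
  then show ?thesis by blast
qed

lemma exists_dyadic_class:
  fixes u b :: real
  assumes "0 < b" "b \<le> u"
  shows "\<exists>k. (1 / 2) ^ k / 2 * u < b \<and> b \<le> (1 / 2) ^ k * u"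
proof -
  obtain n where "u / b < 2 ^ n" using real_arch_pow[of 2 "u / b"] by auto
  hence ex: "\<exists>n. u / b < 2 ^ Suc n" by (intro exI[of _ n]) (auto intro: less_le_trans)
  define k where "k = (LEAST n. u / b < 2 ^ Suc n)"
  have "u / b < 2 ^ Suc k" unfolding k_def using ex by (rule LeastI_ex)
  moreover have "2 ^ k \<le> u / b"
  proof (cases k)
    case 0
    thus ?thesis using assms by (simp add: field_simps)
  next
    case (Suc m)
    hence "\<not> u / b < 2 ^ Suc m"
      using not_less_Least[of m "\<lambda>n. u / b < 2 ^ Suc n", folded k_def] by simp
    thus ?thesis using Suc by simp
  qed
  ultimately show ?thesis using assms by (intro exI[of _ k]) (auto simp: field_simps power_divide)
qed

lemma radius_in_window:
  fixes r :: "nat \<Rightarrow> real"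
  assumes "r \<longlonglongrightarrow> 0" "\<And>n. \<beta> * r n \<le> r (Suc n)" "0 < \<beta>" "0 < t" "\<beta> * t \<le> r 0"
  shows "\<exists>n. \<beta> * t \<le> r n \<and> r n \<le> t"
proof -
  have "\<exists>n. r n \<le> t"
    using order_tendstoD(2)[OF assms(1,4)] by (auto simp: eventually_sequentially intro: less_imp_le)
  define n where "n = (LEAST n. r n \<le> t)"
  have n: "r n \<le> t" unfolding n_def by (rule LeastI_ex) fact
  moreover have "\<beta> * t \<le> r n"
  proof (cases n)
    case (Suc m)
    hence "\<not> r m \<le> t" using not_less_Least[of m "\<lambda>n. r n \<le> t", folded n_def] by simp
    hence "\<beta> * t \<le> \<beta> * r m" using assms(3) by simp
    thus ?thesis using assms(2)[of m] Suc by simp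
  qed (use assms(5) in simp)
  ultimately show ?thesis by blast
qed

text \<open>
  The \<open>k\<close>-th interval issued by a ball of radius \<open>r\<close> has radius \<open>L * T * (r / X k)\<close>, twice the bound of
  \<open>class_interval\<close>, to make the inequality strict.  If \<open>y\<close> were endangered, take a dangerous
  point of least denominator; its class is due at some ball of the play, and the interval issued there
  contains \<open>y\<close>.  Assuming \<open>lines\<close> instead of a property of \<open>\<theta>\<close> lets the lemma cover \<open>i = 0\<close>.
\<close>

lemma winning_avoiding:
  fixes i j \<theta> \<kappa> \<beta> :: real
  assumes ij: "0 \<le> i" "0 < j" "i + j = 1" and \<kappa>: "0 < \<kappa>" and \<beta>: "0 < \<beta>" "\<beta> < 1 / 3"
    and lines: "\<And>p s q. 1 \<le> q \<Longrightarrow> \<bar>of_int q * \<theta> - of_int p\<bar> * of_int q powr i \<le> \<kappa> \<Longrightarrow>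
       \<exists>A B C. line_through i j p s q A B C"
    and S: "\<And>y. y \<in> J \<Longrightarrow> y \<in> avoiding i j \<theta> \<Longrightarrow> y \<in> S"
  shows "beta_absolute_winning_from J \<beta> S"
proof -
  define \<gamma> where "\<gamma> = ln (2 / 3) / ln \<beta>"
  have ln\<beta>: "ln \<beta> < 0" using \<beta> by simp
  have \<gamma>: "0 < \<gamma>" unfolding \<gamma>_def using ln\<beta> by (intro divide_neg_neg) auto
  have \<beta>\<gamma>: "\<beta> powr \<gamma> = 2 / 3" using \<beta> ln\<beta> by (simp add: powr_def \<gamma>_def)
  define e X :: "nat \<Rightarrow> real" where "e k = (1 / 2) ^ k" and "X k = 2 powr (j * k / 3)" for k
  have e: "0 < e k" "e k \<le> 1" for k by (simp_all add: e_def power_le_one)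
  have X: "1 \<le> X k" for k using ij by (simp add: X_def ge_one_powr_ge_zero)
  have eX: "e k powr j * X k ^ 3 = 1" for k
  proof -
    have "e k = 2 powr (- real k)" by (simp add: e_def powr_minus powr_realpow power_one_over inverse_eq_divide)
    hence "e k powr j = 2 powr (- (j * k))" by (simp add: powr_powr mult.commute)
    moreover have "X k ^ 3 = 2 powr (j * k)"
      by (simp add: X_def powr_realpow[symmetric] powr_powr del: powr_numeral)
    ultimately show ?thesis by (simp add: powr_minus)
  qed
  define h where "h = 2 powr (- (j * \<gamma> / 3))"
  have h: "0 < h" "h < 1" using ij \<gamma> by (simp_all add: h_def powr_less_one)
  have hX: "(1 / X k) powr \<gamma> = h ^ k" for k
  proof -
    have "1 / X k = 2 powr (- (j * k / 3))" by (simp add: X_def powr_minus_divide)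
    thus ?thesis by (simp add: h_def powr_powr powr_realpow[symmetric] mult_ac del: powr_realpow)
  qed
  define L where "L = 4 * (4 / \<beta>)\<^sup>2 / \<beta>"
  have L: "0 < L" using \<beta> by (simp add: L_def)
  \<comment> \<open>\<open>T \<le> r\<^sub>0\<close> prevents classes from being due before the game starts, \<open>T \<le> \<kappa>\<close> provides lines, the
    third bound is that of \<open>class_shares_crossing\<close>, and the last makes the weights small.\<close>
  define T where "T r\<^sub>0 = Min {r\<^sub>0, \<kappa>, 1 / (216 * (8 / \<beta>) ^ 4), ((1 - h) / 12) powr (1 / \<gamma>) / L}" for r\<^sub>0
  have T: "0 < T r\<^sub>0" "T r\<^sub>0 \<le> r\<^sub>0" "T r\<^sub>0 \<le> \<kappa>" "T r\<^sub>0 \<le> 1 / (216 * (8 / \<beta>) ^ 4)"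
      "T r\<^sub>0 \<le> ((1 - h) / 12) powr (1 / \<gamma>) / L" if "0 < r\<^sub>0" for r\<^sub>0
    using that \<kappa> \<beta> h L unfolding T_def by auto
  have T1: "216 * (8 / \<beta>) ^ 4 * T r\<^sub>0 \<le> 1" "T r\<^sub>0 \<le> 1" "(L * T r\<^sub>0) powr \<gamma> \<le> (1 - h) / 12" if "0 < r\<^sub>0" for r\<^sub>0
  proof -
    show *: "216 * (8 / \<beta>) ^ 4 * T r\<^sub>0 \<le> 1" using T(4)[OF that] \<beta> by (simp add: field_simps)
    have "1 \<le> (8 / \<beta>) ^ 4" using \<beta> by (intro one_le_power) (simp add: field_simps)
    hence "1 * T r\<^sub>0 \<le> 216 * (8 / \<beta>) ^ 4 * T r\<^sub>0" using T(1)[OF that] by (intro mult_right_mono) auto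
    thus "T r\<^sub>0 \<le> 1" using * by linarith
    have "L * T r\<^sub>0 \<le> ((1 - h) / 12) powr (1 / \<gamma>)" using T(5)[OF that] L by (simp add: field_simps)
    hence "(L * T r\<^sub>0) powr \<gamma> \<le> (((1 - h) / 12) powr (1 / \<gamma>)) powr \<gamma>"
      using \<gamma> L T(1)[OF that] by (intro powr_mono2) auto
    also have "\<dots> = (1 - h) / 12" using \<gamma> h by (simp add: powr_powr)
    finally show "(L * T r\<^sub>0) powr \<gamma> \<le> (1 - h) / 12" .
  qed
  define P where "P r\<^sub>0 x r k z \<longleftrightarrow> (\<forall>y\<in>cball x r. \<forall>p s q A B C. line_through i j p s q A B C \<longrightarrow>
     dangerous i j \<theta> ((T r\<^sub>0)\<^sup>2) y p s q \<longrightarrow> in_class j \<beta> (T r\<^sub>0) (e k) r (X k) q B \<longrightarrow>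
     (\<forall>p' s' q'. dangerous i j \<theta> ((T r\<^sub>0)\<^sup>2) y p' s' q' \<longrightarrow> q \<le> q') \<longrightarrow>
     \<bar>y - z\<bar> \<le> 2 * (4 / \<beta>)\<^sup>2 * T r\<^sub>0 / \<beta> * (r / X k))" for r\<^sub>0 x r k z
  define z where "z r\<^sub>0 x r k = (SOME z. P r\<^sub>0 x r k z)" for r\<^sub>0 x r k
  have z: "P r\<^sub>0 x r k (z r\<^sub>0 x r k)" if "0 < r\<^sub>0" "0 < r" for r\<^sub>0 x r k
    unfolding z_def
  proof (rule someI_ex)
    show "\<exists>z. P r\<^sub>0 x r k z" unfolding P_def
      using class_interval[OF ij \<beta>(1) _ T(1)[OF that(1)] T1(1)[OF that(1)] e X eX that(2)] \<beta> by simp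
  qed
  define \<rho> where "\<rho> r\<^sub>0 r k = L * T r\<^sub>0 * (r / X k)" for r\<^sub>0 r k
  \<comment> \<open>Since \<open>2 ^ k \<le> q\<close> in the \<open>k\<close>-th class, only classes up to \<open>K r\<close> are due at radius \<open>r\<close>.\<close>
  define K where "K r = nat \<lceil>3 / 2 * log 2 (2 / r)\<rceil>" for r :: real
  define F where "F r\<^sub>0 x r = (\<lambda>k. (z r\<^sub>0 x r k, \<rho> r\<^sub>0 r k)) ` {..K r}" for r\<^sub>0 x r
  show ?thesis
  proof (rule winning_by_covers[OF \<beta>(1) \<gamma> \<beta>\<gamma>, where F = F])
    show "finite (F r\<^sub>0 x r)" for r\<^sub>0 x r by (simp add: F_def)
    show "0 < \<rho>'" if "0 < r\<^sub>0" "0 < r" "(z', \<rho>') \<in> F r\<^sub>0 x r" for r\<^sub>0 x r z' \<rho>'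
      using that T(1)[of r\<^sub>0] L X less_le_trans[OF zero_less_one X] by (auto simp: F_def \<rho>_def)
    show "(\<Sum>(z', \<rho>') \<in> F r\<^sub>0 x r. \<rho>' powr \<gamma>) \<le> r powr \<gamma> / 12" if "0 < r\<^sub>0" "0 < r" for r\<^sub>0 x r
    proof -
      have "(\<Sum>(z', \<rho>') \<in> F r\<^sub>0 x r. \<rho>' powr \<gamma>) \<le> (\<Sum>k\<le>K r. \<rho> r\<^sub>0 r k powr \<gamma>)"
        unfolding F_def using sum_image_le[of "{..K r}" "\<lambda>(z', \<rho>'). \<rho>' powr \<gamma>"
            "\<lambda>k. (z r\<^sub>0 x r k, \<rho> r\<^sub>0 r k)"] by (simp add: comp_def)
      also have "\<dots> = (\<Sum>k\<le>K r. (L * T r\<^sub>0) powr \<gamma> * r powr \<gamma> * h ^ k)"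
      proof (rule sum.cong[OF refl])
        fix k
        have "\<rho> r\<^sub>0 r k = L * T r\<^sub>0 * (r * (1 / X k))" by (simp add: \<rho>_def)
        thus "\<rho> r\<^sub>0 r k powr \<gamma> = (L * T r\<^sub>0) powr \<gamma> * r powr \<gamma> * h ^ k"
          unfolding hX[symmetric] using L T(1)[OF that(1)] that(2) less_le_trans[OF zero_less_one X[of k]]
          by (simp only: powr_mult mult.assoc)
      qed
      also have "\<dots> = (L * T r\<^sub>0) powr \<gamma> * r powr \<gamma> * (\<Sum>k\<le>K r. h ^ k)"
        by (simp add: sum_distrib_left)
      also have "\<dots> \<le> (L * T r\<^sub>0) powr \<gamma> * r powr \<gamma> * (1 / (1 - h))"
      proof (rule mult_left_mono)
        have "(\<Sum>k\<le>K r. h ^ k) = (1 - h ^ Suc (K r)) / (1 - h)"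
          using h by (simp add: sum_gp0)
        also have "\<dots> \<le> 1 / (1 - h)" using h by (intro divide_right_mono) auto
        finally show "(\<Sum>k\<le>K r. h ^ k) \<le> 1 / (1 - h)" .
      qed simp
      also have "\<dots> \<le> (1 - h) / 12 * r powr \<gamma> * (1 / (1 - h))"
        using T1(3)[OF that(1)] h by (intro mult_right_mono) auto
      also have "\<dots> = r powr \<gamma> / 12"
      proof -
        have cancel: "d / 12 * w * (1 / d) = w / 12" if "d \<noteq> 0" for d w :: real using that by simp
        show ?thesis by (rule cancel) (use h in simp)
      qed
      finally show ?thesis .
    qed
  next
    fix x r y
    assume J: "cball (x 0) (r 0) \<subseteq> J" and r: "\<And>n. 0 < r n" "\<And>n. \<beta> * r n \<le> r (Suc n)" "r \<longlonglongrightarrow> 0"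
      and y: "\<And>n. y \<in> cball (x n) (r n)"
      and out: "\<And>n z' \<rho>'. (z', \<rho>') \<in> F (r 0) (x n) (r n) \<Longrightarrow> y \<notin> ball z' \<rho>'"
    define t where "t = T (r 0)"
    note t = T[OF r(1)[of 0], folded t_def] and t1 = T1[OF r(1)[of 0], folded t_def]
    have "\<not> dangerous i j \<theta> (t\<^sup>2) y p s q" for p s q
    proof
      assume "dangerous i j \<theta> (t\<^sup>2) y p s q"
      define D where "D n \<longleftrightarrow> (\<exists>p s. dangerous i j \<theta> (t\<^sup>2) y p s (int n))" for n
      have "D (nat q)" using \<open>dangerous i j \<theta> (t\<^sup>2) y p s q\<close>
        unfolding D_def by (auto simp: dangerous_def)
      define n where "n = (LEAST n. D n)"
      have "D n" unfolding n_def using \<open>D (nat q)\<close> by (rule LeastI)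
      then obtain p s where d: "dangerous i j \<theta> (t\<^sup>2) y p s (int n)" by (auto simp: D_def)
      have least: "int n \<le> q'" if "dangerous i j \<theta> (t\<^sup>2) y p' s' q'" for p' s' q'
      proof -
        have "D (nat q')" using that unfolding D_def by (auto simp: dangerous_def)
        hence "n \<le> nat q'" unfolding n_def by (rule Least_le)
        thus ?thesis using that by (auto simp: dangerous_def)
      qed
      define Q where "Q = real n"
      have Q: "1 \<le> Q" "real_of_int (int n) = Q" using d by (auto simp: Q_def dangerous_def)
      have "t\<^sup>2 \<le> \<kappa>" using t(1,3) t1(2) mult_left_le[of t t] unfolding power2_eq_square by linarith
      then obtain A B C where line: "line_through i j p s (int n) A B C"
        using lines[of "int n" p s] d by (auto simp: dangerous_def)
      have B: "1 \<le> real_of_int B" "of_int B \<le> Q powr j" using line Q by (auto simp: line_through_def)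
      obtain k where k: "e k / 2 * Q powr j < of_int B" "of_int B \<le> e k * Q powr j"
        using exists_dyadic_class[of "of_int B" "Q powr j"] B by (auto simp: e_def)
      have k2: "2 ^ k \<le> Q"
      proof -
        have "1 \<le> e k * Q powr j" using B k by linarith
        hence "2 ^ k \<le> Q powr j" by (simp add: e_def power_divide field_simps)
        also have "\<dots> \<le> Q powr 1" using Q ij by (intro powr_mono) auto
        finally show ?thesis using Q by simp
      qed
      have Xk: "X k \<le> 2 powr (k / 3)" unfolding X_def using ij mult_left_le_one_le[of "real k" j] by (intro powr_mono) auto
      have QB: "Q \<le> Q * of_int B" using mult_left_mono[OF B(1), of Q] Q by simp
      \<comment> \<open>The largest radius at which the class is due; Bob cannot jump over \<open>{\<beta> * u..u}\<close>.\<close>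
      define u where "u = 2 * t * X k / (Q * of_int B)"
      have pos: "0 < Q * of_int B" using Q B by simp
      have uQB: "u * (Q * of_int B) = 2 * t * X k" unfolding u_def using Q B by auto
      have u: "0 < u" "\<beta> * u \<le> r 0"
      proof -
        have "0 < 2 * t * X k" using t(1) X[of k] by simp
        thus "0 < u" unfolding u_def by (rule divide_pos_pos[OF _ pos])
        have "2 powr (k / 3) \<le> (2 :: real) powr real k" by (intro powr_mono) auto
        hence "X k \<le> 2 powr real k" using Xk by linarith
        hence "X k \<le> Q * of_int B" using k2 QB by (simp add: powr_realpow)
        hence "2 * t * X k \<le> 2 * t * (Q * of_int B)" using t(1) by (intro mult_left_mono) auto
        hence "u \<le> 2 * t" unfolding u_def pos_divide_le_eq[OF pos] .
        hence "\<beta> * u \<le> \<beta> * (2 * t)" using \<beta> by simp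
        also have "\<dots> \<le> t" using \<beta> t(1) by simp
        finally show "\<beta> * u \<le> r 0" using t(2) by linarith
      qed
      obtain m where m: "\<beta> * u \<le> r m" "r m \<le> u" using radius_in_window[OF r(3,2) \<beta>(1) u] by blast
      have le: "Q * of_int B * r m \<le> 2 * t * X k"
        using mult_right_mono[OF m(2) less_imp_le[OF pos]] uQB by (simp add: mult_ac)
      have "\<beta> * (u * (Q * of_int B)) \<le> Q * of_int B * r m"
        using mult_right_mono[OF m(1) less_imp_le[OF pos]] by (simp add: mult_ac)
      hence "2 * \<beta> * t * X k \<le> Q * of_int B * r m" unfolding uQB by (simp add: mult_ac)
      moreover have "0 < \<beta> * t * X k"
        using mult_pos_pos[OF mult_pos_pos[OF \<beta>(1) t(1)] less_le_trans[OF zero_less_one X[of k]]] .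
      hence "\<beta> * t * X k \<le> 2 * \<beta> * t * X k" by linarith
      ultimately have cls: "in_class j \<beta> t (e k) (r m) (X k) (int n) B"
        using k le Q by (simp add: in_class_def)
      have "k \<le> K (r m)"
      proof -
        have "2 powr (real k) * r m \<le> Q * of_int B * r m"
          using k2 QB r(1)[of m] by (intro mult_right_mono) (auto simp: powr_realpow)
        also have "\<dots> \<le> 2 * t * X k" by (rule le)
        also have "\<dots> \<le> 2 * 1 * 2 powr (k / 3)" using t1(2) t(1) Xk X[of k] by (intro mult_mono) auto
        finally have "2 powr (real k) * r m / 2 powr (k / 3) \<le> 2" by (simp add: field_simps)
        moreover have "2 powr (real k) / 2 powr (k / 3) = 2 powr (2 * k / 3)"
          by (simp add: powr_diff[symmetric])
        ultimately have "2 powr (2 * k / 3) * r m \<le> 2" by (simp add: field_simps)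
        hence "2 powr (2 * k / 3) \<le> 2 / r m" using r(1)[of m] by (simp add: field_simps)
        hence "2 * k / 3 \<le> log 2 (2 / r m)" using r(1)[of m] by (subst le_log_iff) auto
        thus ?thesis unfolding K_def by linarith
      qed
      hence "(z (r 0) (x m) (r m) k, \<rho> (r 0) (r m) k) \<in> F (r 0) (x m) (r m)" by (simp add: F_def)
      hence "y \<notin> ball (z (r 0) (x m) (r m) k) (\<rho> (r 0) (r m) k)" by (rule out)
      moreover have "\<bar>y - z (r 0) (x m) (r m) k\<bar> \<le> \<rho> (r 0) (r m) k / 2"
      proof -
        have "P (r 0) (x m) (r m) k (z (r 0) (x m) (r m) k)" by (rule z) (rule r)+
        hence "\<bar>y - z (r 0) (x m) (r m) k\<bar> \<le> 2 * (4 / \<beta>)\<^sup>2 * t / \<beta> * (r m / X k)"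
          unfolding P_def t_def[symmetric] using y[of m] line d cls least by blast
        thus ?thesis unfolding \<rho>_def L_def t_def[symmetric] by (simp add: mult_ac)
      qed
      moreover have "0 < \<rho> (r 0) (r m) k"
        unfolding \<rho>_def t_def[symmetric]
        using mult_pos_pos[OF mult_pos_pos[OF L t(1)]
            divide_pos_pos[OF r(1) less_le_trans[OF zero_less_one X]]] .
      ultimately show False by (simp add: dist_real_def abs_minus_commute)
    qed
    hence "y \<in> avoiding i j \<theta>" unfolding avoiding_def using t(1) by (auto intro!: exI[of _ "t\<^sup>2"])
    thus "y \<in> S" using S y[of 0] J by blast
  qed
qed

lemma bad_single_lines:
  assumes i: "0 < i" and j: "0 \<le> j" and ij: "i + j = 1" and \<theta>: "\<theta> \<in> bad_single i"
  obtains c where "0 < c" "\<And>p s q. 1 \<le> q \<Longrightarrow> \<bar>of_int q * \<theta> - of_int p\<bar> * of_int q powr i \<le> c \<Longrightarrow>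
       \<exists>A B C. line_through i j p s q A B C"
proof -
  obtain c where c: "c > 0" "\<And>(p::int) (q::nat). q \<ge> 1 \<Longrightarrow> c < real q powr (1 / i) * \<bar>real q * \<theta> - of_int p\<bar>"
    using \<theta> i by (auto simp: bad_single_def)
  have "c < of_int q powr (1 / i) * \<bar>of_int q * \<theta> - of_int p\<bar>" if "1 \<le> q" for p q :: int
    using c(2)[of "nat q" p] that by simp
  thus ?thesis using exists_line_through[OF i j ij, of c \<theta>] by (intro that[OF c(1)]) blast
qed

lemma avoiding_imp_bad_pair:
  assumes i: "0 < i" and j: "0 < j" and y: "y \<in> avoiding i j \<theta>"
  shows "(\<theta>, y) \<in> bad_pair i j"
proof -
  obtain \<delta> where \<delta>: "0 < \<delta>" "\<And>p s q. \<not> dangerous i j \<theta> \<delta> y p s q"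
    using y by (auto simp: avoiding_def)
  define c where "c = min (\<delta> powr (1 / i)) (\<delta> powr (1 / j))"
  have root: "v * real q powr t \<le> \<delta>"
    if "real q * v powr (1 / t) \<le> c" "c \<le> \<delta> powr (1 / t)" "0 \<le> v" "0 < t" "1 \<le> q" for v t :: real and q :: nat
  proof -
    have "v * real q powr t = (real q * v powr (1 / t)) powr t"
      using that by (simp add: powr_mult powr_powr)
    also have "\<dots> \<le> (\<delta> powr (1 / t)) powr t" using that by (intro powr_mono2) auto
    also have "\<dots> = \<delta>" using that \<delta>(1) by (simp add: powr_powr)
    finally show ?thesis .
  qed
  have "c < max (real q * \<bar>real q * \<theta> - of_int p1\<bar> powr (1 / i)) (real q * \<bar>real q * y - of_int p2\<bar> powr (1 / j))"
    if "1 \<le> q" for p1 p2 :: int and q :: nat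
  proof (rule ccontr)
    assume "\<not> ?thesis"
    hence "real q * \<bar>real q * \<theta> - of_int p1\<bar> powr (1 / i) \<le> c"
      "real q * \<bar>real q * y - of_int p2\<bar> powr (1 / j) \<le> c" by auto
    hence "dangerous i j \<theta> \<delta> y p1 p2 (int q)"
      using root[of q _ i] root[of q _ j] i j that by (auto simp: dangerous_def c_def)
    thus False using \<delta>(2) by blast
  qed
  moreover have "0 < c" using \<delta>(1) by (simp add: c_def)
  ultimately show ?thesis unfolding bad_pair_def using i j by auto
qed

text \<open>
  With \<open>\<theta> = 0\<close> and \<open>p = 0\<close> the first coordinate imposes no condition, and what remains is the
  one-dimensional problem.
\<close>

lemma avoiding_imp_BA:
  assumes "y \<in> avoiding 0 1 0"
  shows "y \<in> BA"
proof -
  obtain \<delta> where \<delta>: "0 < \<delta>" "\<And>p s q. \<not> dangerous 0 1 0 \<delta> y p s q"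
    using assms by (auto simp: avoiding_def)
  have "\<delta> < real q * \<bar>real q * y - of_int p\<bar>" if "1 \<le> q" for p :: int and q :: nat
    using \<delta>(2)[of 0 p "int q"] \<delta>(1) that by (auto simp: dangerous_def mult.commute)
  thus ?thesis unfolding BA_def using \<delta>(1) by blast
qed

text \<open>
  For \<open>i = 0\<close> every rational point lies on the horizontal line \<open>q * y - s = 0\<close>, so the
  one-dimensional result is the instance \<open>\<theta> = 0\<close> of \<open>winning_avoiding\<close>.  For \<open>j = 0\<close> the fibre is the
  whole line and any winning strategy does.
\<close>

lemma fibre_winning:
  assumes ij: "0 \<le> i" "0 \<le> j" "i + j = 1" and \<theta>: "\<theta> \<in> bad_single i" and \<beta>: "0 < \<beta>" "\<beta> < 1 / 3"
  shows "beta_absolute_winning_from J \<beta> {y \<in> J. (\<theta>, y) \<in> bad_pair i j}"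
proof -
  consider "i = 1" "j = 0" | "i = 0" "j = 1" | "0 < i" "0 < j" using ij by linarith
  thus ?thesis
  proof cases
    case 1
    have "(\<theta>, y) \<in> bad_pair i j" for y
      using \<theta> 1 by (auto simp: bad_single_def bad_pair_def BA_def)
    hence J: "{y \<in> J. (\<theta>, y) \<in> bad_pair i j} = J" by auto
    show ?thesis unfolding J
    proof (rule winning_avoiding[OF _ _ _ _ \<beta>, of 0 1 1 0])
      show "\<exists>A B C. line_through 0 1 p s q A B C" if "1 \<le> q" for p s q :: int
        using that by (intro exI[of _ 0] exI[of _ q] exI[of _ "- s"]) (auto simp: line_through_def)
    qed auto
  next
    case 2
    show ?thesis
    proof (rule winning_avoiding[OF _ _ _ _ \<beta>, of 0 1 1 0])
      show "\<exists>A B C. line_through 0 1 p s q A B C" if "1 \<le> q" for p s q :: int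
        using that by (intro exI[of _ 0] exI[of _ q] exI[of _ "- s"]) (auto simp: line_through_def)
      show "y \<in> {y \<in> J. (\<theta>, y) \<in> bad_pair i j}" if "y \<in> J" "y \<in> avoiding 0 1 0" for y
        using avoiding_imp_BA that 2 by (auto simp: bad_pair_def)
    qed auto
  next
    case 3
    obtain c where c: "0 < c" "\<And>p s q. 1 \<le> q \<Longrightarrow> \<bar>of_int q * \<theta> - of_int p\<bar> * of_int q powr i \<le> c \<Longrightarrow>
       \<exists>A B C. line_through i j p s q A B C"
      using bad_single_lines[OF 3(1) ij(2,3) \<theta>] by blast
    show ?thesis
      by (rule winning_avoiding[OF ij(1) 3(2) ij(3) c(1) \<beta> c(2)])
        (use avoiding_imp_bad_pair[OF 3] in auto)
  qed
qed

theorem proposition30: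
  fixes i j \<theta> :: real
  assumes "i \<in> {0..1}" and "j \<in> {0..1}" and "i + j = 1"
    and "\<theta> \<in> bad_single i"
  shows "absolute_winning {y. (\<theta>, y) \<in> bad_pair i j \<inter> vertical_line \<theta>} \<and>
         absolute_winning_from {0..1} {y. (\<theta>, y) \<in> bad_pair i j \<inter> vertical_segment \<theta>}"
proof -
  have win: "absolute_winning_from J {y \<in> J. (\<theta>, y) \<in> bad_pair i j}" for J
    unfolding absolute_winning_from_def using fibre_winning assms by simp
  have "{y. (\<theta>, y) \<in> bad_pair i j \<inter> vertical_line \<theta>} = {y \<in> UNIV. (\<theta>, y) \<in> bad_pair i j}"
    by (auto simp: vertical_line_def)
  moreover have "{y. (\<theta>, y) \<in> bad_pair i j \<inter> vertical_segment \<theta>} = {y \<in> {0..1}. (\<theta>, y) \<in> bad_pair i j}"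
    by (auto simp: vertical_segment_def)
  ultimately show ?thesis unfolding absolute_winning_def using win[of UNIV] win[of "{0..1}"] by argo
qed

end
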